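(* For every $\epsilon>0$, \texttt{CleverMaker} has a strategy in the $(1:(1-\epsilon)\frac{n}{2})$ half-random Hamiltonicity game on $E(K_n)$ against \texttt{RandomBreaker} which, asymptotically almost surely (i.e. with probability tending to $1$ as $n\to\infty$), is winning within $n+O(\log n)$ moves of \texttt{CleverMaker}. In particular, the sharp threshold bias for each of the $(1:b)$ half-random connectivity game, minimum-degree-$2$ game, and Hamiltonicity game between \texttt{CleverMaker} and \texttt{RandomBreaker} is $\frac{n}{2}$.
   Context: Maker-Breaker games on the board $E(K_n)$: two players alternately claim previously unclaimed (free) edges of the complete graph $K_n$; in a $(1:b)$-biased game Maker claims $1$ edge per turn and Breaker claims $b$ edges per turn, Maker moves first. Maker wins if his graph contains a member of the winning family, otherwise Breaker wins. The connectivity game: Maker wins if his graph is a connected spanning subgraph of $K_n$. The minimum-degree-$2$ game: Maker wins if every vertex has degree at least $2$ in his graph. The Hamiltonicity game: Maker wins if his graph contains a Hamilton cycle of $K_n$. In the half-random game between \texttt{CleverMaker} and \texttt{RandomBreaker}, Breaker (\texttt{RandomBreaker}) claims in each of her moves an edge chosen uniformly at random among all currently free edges, while Maker (\texttt{CleverMaker}) follows a strategy of his choice. A function $k:\mathbb{N}_0\to\mathbb{N}_0$ is a sharp threshold bias of the $(1:b)$ half-random game if for every $\epsilon>0$: (a) \texttt{RandomBreaker} wins the $(1:(1+\epsilon)k(n))$ game with probability tending to $1$ against any strategy of \texttt{CleverMaker}, and (b) \texttt{CleverMaker} has a strategy against which \texttt{RandomBreaker} loses the $(1:(1-\epsilon)k(n))$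 game with probability tending to $1$. Games and strategies are understood as sequences indexed by $n$; biases are rounded to integers. *)

theory Defs
  imports "HOL-Probability.Probability" "HOL-Library.Landau_Symbols"
begin

type_synonym edge = "nat set"

definition complete_edges :: "nat \<Rightarrow> edge set" where
  "complete_edges n = {e. e \<subseteq> {..<n} \<and> card e = 2}"

datatype player = Maker | Breaker

text \<open>A history lists the edges claimed so far in chronological order, each with its owner.\<close>

type_synonym history = "(player \<times> edge) list"

definition claimed_by :: "player \<Rightarrow> history \<Rightarrow> edge set" where
  "claimed_by p h = {e. (p, e) \<in> set h}"

definition free_edges :: "nat \<Rightarrow> history \<Rightarrow> edge set" where
  "free_edges n h = complete_edges n - (claimed_by Maker h \<union> claimed_by Breaker h)"

type_synonym strategy = "history \<Rightarrow> edge"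

definition legal_strategy :: "nat \<Rightarrow> strategy \<Rightarrow> bool" where
  "legal_strategy n \<sigma> \<longleftrightarrow> (\<forall>h. free_edges n h \<noteq> {} \<longrightarrow> \<sigma> h \<in> free_edges n h)"

definition maker_turn :: "nat \<Rightarrow> strategy \<Rightarrow> history \<Rightarrow> history" where
  "maker_turn n \<sigma> h = (if free_edges n h = {} then h else h @ [(Maker, \<sigma> h)])"

definition random_breaker_claim :: "nat \<Rightarrow> history \<Rightarrow> history pmf" where
  "random_breaker_claim n h =
     (if free_edges n h = {} then return_pmf h
      else map_pmf (\<lambda>e. h @ [(Breaker, e)]) (pmf_of_set (free_edges n h)))"

text \<open>In one turn the \<open>b\<close> edges are claimed one after the other; if fewer than \<open>b\<close> edges are free,
  all of them are claimed.\<close>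

primrec random_breaker_turn :: "nat \<Rightarrow> nat \<Rightarrow> history \<Rightarrow> history pmf" where
  "random_breaker_turn n 0 h = return_pmf h"
| "random_breaker_turn n (Suc b) h = bind_pmf (random_breaker_claim n h) (random_breaker_turn n b)"

text \<open>The history after \<open>t\<close> rounds of the \<open>(1:b)\<close> game, that is, after \<open>t\<close> moves of each player
  (or earlier, when the board is exhausted).\<close>

primrec half_random_game :: "nat \<Rightarrow> nat \<Rightarrow> strategy \<Rightarrow> nat \<Rightarrow> history pmf" where
  "half_random_game n b \<sigma> 0 = return_pmf []"
| "half_random_game n b \<sigma> (Suc t) =
     bind_pmf (half_random_game n b \<sigma> t) (\<lambda>h. random_breaker_turn n b (maker_turn n \<sigma> h))"

text \<open>Every round claims at least one edge while one is free, so the number of edges of the board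
  bounds the number of rounds of the complete game.\<close>

definition full_half_random_game :: "nat \<Rightarrow> nat \<Rightarrow> strategy \<Rightarrow> history pmf" where
  "full_half_random_game n b \<sigma> = half_random_game n b \<sigma> (card (complete_edges n))"

text \<open>A game is given by the predicate telling which edge sets on \<open>{..<n}\<close> are winning for Maker.\<close>

type_synonym game = "nat \<Rightarrow> edge set \<Rightarrow> bool"

definition maker_wins :: "game \<Rightarrow> nat \<Rightarrow> history set" where
  "maker_wins W n = {h. W n (claimed_by Maker h)}"

definition breaker_wins :: "game \<Rightarrow> nat \<Rightarrow> history set" where
  "breaker_wins W n = - maker_wins W n"

definition connectivity_game :: game where
  "connectivity_game n E \<longleftrightarrow> (\<forall>u<n. \<forall>v<n. (u, v) \<in> {(x, y). {x, y} \<in> E}\<^sup>*)"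

definition min_degree_2_game :: game where
  "min_degree_2_game n E \<longleftrightarrow> (\<forall>v<n. card {e \<in> E. v \<in> e} \<ge> 2)"

definition hamilton_cycle :: "nat \<Rightarrow> edge set \<Rightarrow> bool" where
  "hamilton_cycle n C \<longleftrightarrow> n \<ge> 3 \<and>
     (\<exists>xs. distinct xs \<and> set xs = {..<n} \<and> C = {{xs ! i, xs ! (Suc i mod n)} |i. i < n})"

definition hamiltonicity_game :: game where
  "hamiltonicity_game n E \<longleftrightarrow> (\<exists>C\<subseteq>E. hamilton_cycle n C)"

text \<open>Biases are rounded down; a negative value (\<open>\<epsilon> > 1\<close>) gives bias \<open>0\<close>.\<close>

definition bias :: "real \<Rightarrow> nat" where
  "bias x = nat \<lfloor>x\<rfloor>"

definition sharp_threshold_bias :: "game \<Rightarrow> (nat \<Rightarrow> nat) \<Rightarrow> bool" where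
  "sharp_threshold_bias W k \<longleftrightarrow> (\<forall>\<epsilon>>0.
     (\<forall>S. (\<forall>n. legal_strategy n (S n)) \<longrightarrow>
        (\<lambda>n. measure_pmf.prob (full_half_random_game n (bias ((1 + \<epsilon>) * real (k n))) (S n))
               (breaker_wins W n)) \<longlonglongrightarrow> 1) \<and>
     (\<exists>S. (\<forall>n. legal_strategy n (S n)) \<and>
        (\<lambda>n. measure_pmf.prob (full_half_random_game n (bias ((1 - \<epsilon>) * real (k n))) (S n))
               (maker_wins W n)) \<longlonglongrightarrow> 1))"

end

theory Submission
  imports Defs "HOL-Real_Asymp.Real_Asymp"
begin

text \<open>
  Above the threshold Breaker leaves fewer than \<open>n - 1\<close> edges to Maker, whatever the strategies.

  Below the threshold a fraction \<open>\<delta> = \<epsilon> / 2\<close> of the board is still free at the end, so Breaker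
  owns a given set of \<open>q\<close> edges with probability at most \<open>(1 - \<delta>)\<^sup>q\<close>. For \<open>L\<close> a large
  multiple of \<open>ln n\<close> it follows that almost surely Breaker never owns all edges between two disjoint
  sets of \<open>L\<close> vertices, nor all edges from a vertex to one of the \<open>n div L\<close> consecutive blocks
  of \<open>L\<close> vertices. Maker spends \<open>n\<close> rounds on depth-first search in the graph of edges that are not
  Breaker's; as no edge leads from the processed to the unvisited vertices, the search yields a path
  that misses at most \<open>2 L\<close> vertices. An edge between the first and the last \<open>L\<close> vertices of this path
  closes a cycle missing at most \<open>4 L\<close> vertices, and every missing vertex is absorbed at the
  cost of three new edges. So \<open>12 L + 1\<close> specific edges complete a Hamilton cycle, and Breaker hits one
  of them while Maker claims them with probability only \<open>O(L\<^sup>2 / n)\<close>.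
\<close>

section \<open>Histories of the game\<close>

text \<open>Over \<open>n\<close> rounds Breaker may occupy a constant fraction of the board, so
  Maker cannot commit to particular edges early on: the search keeps the choice open, and only O(log
  n) edges are left to a phase in which they are prescribed. The obstacle to the probability
  estimates is that Breaker draws without replacement from a board that an adaptive Maker depletes
  as well. Two potentials handle this: neither grows on average under a random claim, nor at all
  under a legal claim of Maker, so the resulting bounds hold against every strategy. They concern
  edge sets fixed in advance, and this shapes the argument: the first phase rests on a property of
  Breaker's graph alone, accessible to a union bound and inherited by all earlier positions because
  that graph only grows. Once it holds after \<open>n\<close> rounds, search and absorption are
  deterministic. The edges of the second phase depend on the play, so their risk is estimated
  conditionally on the position after \<open>n\<close> rounds.\<close>

lemma finite_complete_edges [simp]: "finite (complete_edges n)"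
  unfolding complete_edges_def by (rule finite_subset[of _ "Pow {..<n}"]) auto

lemma finite_free_edges [simp]: "finite (free_edges n h)"
  by (simp add: free_edges_def)

lemma card_complete_edges: "real (card (complete_edges n)) = real n * (real n - 1) / 2"
proof -
  have "card (complete_edges n) = n choose 2"
    unfolding complete_edges_def using n_subsets[of "{..<n}" 2] by simp
  then show ?thesis
    by (cases n) (simp_all add: choose_two real_of_nat_div algebra_simps)
qed

lemma pair_in_complete_edges: "u < n \<Longrightarrow> v < n \<Longrightarrow> u \<noteq> v \<Longrightarrow> {u, v} \<in> complete_edges n"
  by (simp add: complete_edges_def)

lemma claimed_by_append: "claimed_by p (h @ h') = claimed_by p h \<union> claimed_by p h'"
  by (auto simp: claimed_by_def)

lemma claimed_by_Cons [simp]: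
  "claimed_by p ((q, e) # h) = (if p = q then insert e (claimed_by p h) else claimed_by p h)"
  by (auto simp: claimed_by_def)

lemma claimed_by_Nil [simp]: "claimed_by p [] = {}"
  by (simp add: claimed_by_def)

lemma finite_claimed_by [simp]: "finite (claimed_by p h)"
proof -
  have "claimed_by p h \<subseteq> snd ` set h"
    by (force simp: claimed_by_def)
  then show ?thesis
    by (rule finite_subset) simp
qed

definition valid_history :: "nat \<Rightarrow> history \<Rightarrow> bool" where
  "valid_history n h \<longleftrightarrow> distinct (map snd h) \<and> snd ` set h \<subseteq> complete_edges n"

lemma valid_history_Nil [simp]: "valid_history n []"
  by (simp add: valid_history_def)

lemma free_edges_eq: "free_edges n h = complete_edges n - snd ` set h"
proof -
  have "claimed_by Maker h \<union> claimed_by Breaker h = snd ` set h"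
  proof (intro set_eqI iffI)
    fix e assume "e \<in> snd ` set h"
    then obtain p where "(p, e) \<in> set h" by auto
    then show "e \<in> claimed_by Maker h \<union> claimed_by Breaker h"
      by (cases p) (auto simp: claimed_by_def)
  qed (force simp: claimed_by_def)
  then show ?thesis by (simp add: free_edges_def)
qed

lemma valid_history_snoc:
  "valid_history n h \<Longrightarrow> e \<in> free_edges n h \<Longrightarrow> valid_history n (h @ [(p, e)])"
  by (auto simp: valid_history_def free_edges_eq)

lemma card_free_edges:
  assumes "valid_history n h"
  shows "card (free_edges n h) + length h = card (complete_edges n)"
proof -
  have "card (snd ` set h) = length h"
    using assms distinct_card[of "map snd h"] by (simp add: valid_history_def)
  moreover have "snd ` set h \<subseteq> complete_edges n"
    using assms by (simp add: valid_history_def)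
  ultimately show ?thesis
    using card_mono[OF finite_complete_edges, of "snd ` set h" n]
    by (simp add: free_edges_eq card_Diff_subset)
qed

lemma claimed_disjoint:
  assumes "valid_history n h"
  shows "claimed_by Maker h \<inter> claimed_by Breaker h = {}"
proof (rule ccontr)
  assume "\<not> ?thesis"
  then obtain e where "(Maker, e) \<in> set h" "(Breaker, e) \<in> set h"
    by (auto simp: claimed_by_def)
  moreover have "inj_on snd (set h)"
    using assms by (simp add: valid_history_def distinct_map)
  ultimately show False
    using inj_onD[of snd "set h" "(Maker, e)" "(Breaker, e)"] by simp
qed

lemma claimed_subset: "valid_history n h \<Longrightarrow> claimed_by p h \<subseteq> complete_edges n"
  by (force simp: claimed_by_def valid_history_def)

lemma free_edges_nonempty:
  "valid_history n h \<Longrightarrow> length h < card (complete_edges n) \<Longrightarrow> free_edges n h \<noteq> {}"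
  using card_free_edges[of n h] by auto

lemma breaker_turn_invariant:
  assumes "h' \<in> set_pmf (random_breaker_turn n b h)" "P h"
    and "\<And>h e. P h \<Longrightarrow> e \<in> free_edges n h \<Longrightarrow> P (h @ [(Breaker, e)])"
  shows "P h'"
  using assms(1,2)
proof (induction b arbitrary: h)
  case (Suc b)
  then obtain h1 where h1: "h1 \<in> set_pmf (random_breaker_claim n h)"
    "h' \<in> set_pmf (random_breaker_turn n b h1)" by auto
  have "P h1"
    using h1(1) Suc.prems(2) assms(3)
    by (auto simp: random_breaker_claim_def set_pmf_of_set split: if_splits)
  then show ?case using Suc.IH h1(2) by blast
qed auto

text \<open>The arbitrary starting position allows conditioning on the play so far;
  \<open>half_random_game_add\<close> is the Markov property that glues the two stages.\<close>

primrec continued_game :: "nat \<Rightarrow> nat \<Rightarrow> strategy \<Rightarrow> nat \<Rightarrow> history \<Rightarrow> history pmf" where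
  "continued_game n b \<sigma> 0 h = return_pmf h"
| "continued_game n b \<sigma> (Suc t) h =
     bind_pmf (continued_game n b \<sigma> t h) (\<lambda>h. random_breaker_turn n b (maker_turn n \<sigma> h))"

lemma half_random_game_add:
  "half_random_game n b \<sigma> (t + r) = bind_pmf (half_random_game n b \<sigma> t) (continued_game n b \<sigma> r)"
  by (induction r) (simp_all add: bind_return_pmf' bind_assoc_pmf)

lemma half_random_game_eq: "half_random_game n b \<sigma> t = continued_game n b \<sigma> t []"
  by (induction t) simp_all

lemma continued_game_invariant:
  assumes "h' \<in> set_pmf (continued_game n b \<sigma> t h)" "P h"
    and "\<And>h p e. P h \<Longrightarrow> e \<in> free_edges n h \<Longrightarrow> P (h @ [(p, e)])"
    and "legal_strategy n \<sigma>"
  shows "P h'"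
  using assms(1)
proof (induction t arbitrary: h')
  case (Suc t)
  then obtain h1 where h1: "h1 \<in> set_pmf (continued_game n b \<sigma> t h)"
    "h' \<in> set_pmf (random_breaker_turn n b (maker_turn n \<sigma> h1))" by auto
  have "P (maker_turn n \<sigma> h1)"
    using Suc.IH[OF h1(1)] assms(3,4) by (auto simp: maker_turn_def legal_strategy_def)
  with h1(2) show ?case
    by (rule breaker_turn_invariant) (rule assms(3))
qed (use assms(2) in auto)

lemma continued_game_valid:
  assumes "h' \<in> set_pmf (continued_game n b \<sigma> t h)" "valid_history n h" "legal_strategy n \<sigma>"
  shows "valid_history n h'"
  using assms by (rule_tac continued_game_invariant) (auto intro: valid_history_snoc)

lemma continued_game_append:
  assumes "h' \<in> set_pmf (continued_game n b \<sigma> t h)" "legal_strategy n \<sigma>"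
  shows "\<exists>g. h' = h @ g"
  using assms(1) by (rule continued_game_invariant) (use assms(2) in auto)

lemma breaker_turn_append:
  assumes "h' \<in> set_pmf (random_breaker_turn n b h)"
  shows "\<exists>g. h' = h @ g \<and> claimed_by Maker g = {}"
  using assms by (rule breaker_turn_invariant) (auto simp: claimed_by_append)

lemma breaker_turn_length:
  assumes "h' \<in> set_pmf (random_breaker_turn n b h)" "valid_history n h"
    "length h + b \<le> card (complete_edges n)"
  shows "length h' = length h + b"
  using assms
proof (induction b arbitrary: h)
  case (Suc b)
  then obtain h1 where h1: "h1 \<in> set_pmf (random_breaker_claim n h)"
    "h' \<in> set_pmf (random_breaker_turn n b h1)" by auto
  have "free_edges n h \<noteq> {}"
    using Suc.prems by (intro free_edges_nonempty) auto
  then obtain e where "e \<in> free_edges n h" "h1 = h @ [(Breaker, e)]"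
    using h1(1) by (auto simp: random_breaker_claim_def)
  with Suc.IH[OF h1(2)] Suc.prems show ?case
    by (auto intro: valid_history_snoc)
qed auto

text \<open>No turn is cut short while the rounds fit on the board. The strategy relies on this to
  read the round off the history.\<close>

lemma continued_game_length:
  assumes "h' \<in> set_pmf (continued_game n b \<sigma> t h)" "valid_history n h" "legal_strategy n \<sigma>"
    "length h + t * (b + 1) \<le> card (complete_edges n)"
  shows "length h' = length h + t * (b + 1)"
  using assms(1,4)
proof (induction t arbitrary: h')
  case (Suc t)
  then obtain h1 where h1: "h1 \<in> set_pmf (continued_game n b \<sigma> t h)"
    "h' \<in> set_pmf (random_breaker_turn n b (maker_turn n \<sigma> h1))" by auto
  have len: "length h1 = length h + t * (b + 1)"
    using Suc h1(1) by simp
  have val: "valid_history n h1"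
    using continued_game_valid h1(1) assms by blast
  then have free: "free_edges n h1 \<noteq> {}"
    using Suc.prems len by (intro free_edges_nonempty) auto
  then have "valid_history n (maker_turn n \<sigma> h1)" "length (maker_turn n \<sigma> h1) = Suc (length h1)"
    using val assms(3) by (auto simp: maker_turn_def legal_strategy_def intro!: valid_history_snoc)
  then show ?case
    using breaker_turn_length[OF h1(2)] Suc.prems(2) len by simp
qed simp

section \<open>Potentials along the random play\<close>

lemma nn_integral_random_breaker_claim:
  assumes "free_edges n h \<noteq> {}"
  shows "(\<integral>\<^sup>+h'. ennreal (\<Phi> h') \<partial>measure_pmf (random_breaker_claim n h)) =
    (\<Sum>e\<in>free_edges n h. ennreal (\<Phi> (h @ [(Breaker, e)]))) / real (card (free_edges n h))"
  using assms by (simp add: random_breaker_claim_def nn_integral_pmf_of_set ennreal_of_nat_eq_real_of_nat)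

text \<open>Iterates the estimate for one claim; \<open>m\<close> is the horizon up to which that
  estimate is available, in the applications a number of claims that leaves at least
  \<open>s\<close> edges free.\<close>

lemma breaker_turn_supermartingale:
  assumes claim: "\<And>h. valid_history n h \<Longrightarrow> length h < m \<Longrightarrow>
      (\<integral>\<^sup>+h'. ennreal (\<Phi> h') \<partial>measure_pmf (random_breaker_claim n h)) \<le> ennreal (\<Phi> h)"
    and m: "m \<le> card (complete_edges n)"
    and h: "valid_history n h" "length h + b \<le> m"
  shows "(\<integral>\<^sup>+h'. ennreal (\<Phi> h') \<partial>measure_pmf (random_breaker_turn n b h)) \<le> ennreal (\<Phi> h)"
  using h
proof (induction b arbitrary: h)
  case (Suc b)
  have free: "free_edges n h \<noteq> {}"
    using Suc.prems m by (intro free_edges_nonempty) auto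
  have "(\<integral>\<^sup>+h'. ennreal (\<Phi> h') \<partial>measure_pmf (random_breaker_turn n (Suc b) h)) =
    (\<integral>\<^sup>+h1. (\<integral>\<^sup>+h'. ennreal (\<Phi> h') \<partial>measure_pmf (random_breaker_turn n b h1))
      \<partial>measure_pmf (random_breaker_claim n h))"
    by (simp add: nn_integral_bind_pmf)
  also have "\<dots> \<le> (\<integral>\<^sup>+h1. ennreal (\<Phi> h1) \<partial>measure_pmf (random_breaker_claim n h))"
  proof (intro nn_integral_mono_AE AE_pmfI)
    fix h1 assume "h1 \<in> set_pmf (random_breaker_claim n h)"
    then obtain e where "e \<in> free_edges n h" "h1 = h @ [(Breaker, e)]"
      using free by (auto simp: random_breaker_claim_def)
    then show "(\<integral>\<^sup>+h'. ennreal (\<Phi> h') \<partial>measure_pmf (random_breaker_turn n b h1)) \<le> ennreal (\<Phi> h1)"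
      using Suc.prems by (intro Suc.IH) (auto intro: valid_history_snoc)
  qed
  also have "\<dots> \<le> ennreal (\<Phi> h)"
    using Suc.prems by (intro claim) auto
  finally show ?case .
qed simp

text \<open>Maker's move is treated by a pointwise inequality for every free edge, which makes the
  bound independent of \<open>\<sigma>\<close>.\<close>

lemma continued_game_supermartingale:
  assumes claim: "\<And>h. valid_history n h \<Longrightarrow> length h < m \<Longrightarrow>
      (\<integral>\<^sup>+h'. ennreal (\<Phi> h') \<partial>measure_pmf (random_breaker_claim n h)) \<le> ennreal (\<Phi> h)"
    and maker: "\<And>h e. valid_history n h \<Longrightarrow> length h < m \<Longrightarrow> e \<in> free_edges n h \<Longrightarrow>
      \<Phi> (h @ [(Maker, e)]) \<le> \<Phi> h"
    and m: "m \<le> card (complete_edges n)"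
    and h: "valid_history n h" "length h + t * (b + 1) \<le> m"
    and legal: "legal_strategy n \<sigma>"
  shows "(\<integral>\<^sup>+h'. ennreal (\<Phi> h') \<partial>measure_pmf (continued_game n b \<sigma> t h)) \<le> ennreal (\<Phi> h)"
  using h(2)
proof (induction t)
  case (Suc t)
  have "(\<integral>\<^sup>+h'. ennreal (\<Phi> h') \<partial>measure_pmf (continued_game n b \<sigma> (Suc t) h)) =
    (\<integral>\<^sup>+h1. (\<integral>\<^sup>+h'. ennreal (\<Phi> h') \<partial>measure_pmf (random_breaker_turn n b (maker_turn n \<sigma> h1)))
      \<partial>measure_pmf (continued_game n b \<sigma> t h))"
    by (simp add: nn_integral_bind_pmf)
  also have "\<dots> \<le> (\<integral>\<^sup>+h1. ennreal (\<Phi> h1) \<partial>measure_pmf (continued_game n b \<sigma> t h))"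
  proof (intro nn_integral_mono_AE AE_pmfI)
    fix h1 assume h1: "h1 \<in> set_pmf (continued_game n b \<sigma> t h)"
    have val: "valid_history n h1"
      using continued_game_valid h1 h legal by blast
    have len: "length h1 = length h + t * (b + 1)"
      using continued_game_length[OF h1 h(1) legal] Suc.prems m by simp
    have "free_edges n h1 \<noteq> {}"
      using val len Suc.prems m by (intro free_edges_nonempty) auto
    then have e: "\<sigma> h1 \<in> free_edges n h1" and mt: "maker_turn n \<sigma> h1 = h1 @ [(Maker, \<sigma> h1)]"
      using legal by (auto simp: legal_strategy_def maker_turn_def)
    have "(\<integral>\<^sup>+h'. ennreal (\<Phi> h') \<partial>measure_pmf (random_breaker_turn n b (maker_turn n \<sigma> h1)))
        \<le> ennreal (\<Phi> (maker_turn n \<sigma> h1))"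
      using val e mt len Suc.prems
      by (intro breaker_turn_supermartingale[OF claim m]) (auto intro: valid_history_snoc)
    also have "\<dots> \<le> ennreal (\<Phi> h1)"
      unfolding mt using val e len Suc.prems by (intro ennreal_leI maker) auto
    finally show "(\<integral>\<^sup>+h'. ennreal (\<Phi> h') \<partial>measure_pmf (random_breaker_turn n b (maker_turn n \<sigma> h1)))
        \<le> ennreal (\<Phi> h1)" .
  qed
  also have "\<dots> \<le> ennreal (\<Phi> h)"
    using Suc by simp
  finally show ?case .
qed simp

text \<open>Markov's inequality, with the lower bound on \<open>\<Phi>\<close> asked for only on the
  support of \<open>p\<close>, where validity of the history can be used.\<close>

lemma prob_le_nn_integral:
  assumes "\<And>h. h \<in> set_pmf p \<Longrightarrow> h \<in> A \<Longrightarrow> 1 \<le> \<Phi> h"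
    "(\<integral>\<^sup>+h. ennreal (\<Phi> h) \<partial>measure_pmf p) \<le> ennreal c" "0 \<le> c"
  shows "measure_pmf.prob p A \<le> c"
proof -
  have "ennreal (measure_pmf.prob p A) = (\<integral>\<^sup>+h. indicator A h \<partial>measure_pmf p)"
    by (simp add: measure_pmf.emeasure_eq_measure)
  also have "\<dots> \<le> (\<integral>\<^sup>+h. ennreal (\<Phi> h) \<partial>measure_pmf p)"
    using assms(1) by (intro nn_integral_mono_AE AE_pmfI) (auto simp: indicator_def)
  also have "\<dots> \<le> ennreal c" by fact
  finally show ?thesis using assms(3) by simp
qed

text \<open>The convex function \<open>y ^ j\<close> lies above its tangent at \<open>x\<close>. In
  the induction step, multiplying by \<open>x + d\<close> produces the new bound plus a nonnegative
  term with \<open>d ^ 2\<close>.\<close>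

lemma power_add_ge_linear:
  fixes x d :: real
  assumes "0 \<le> x" "0 \<le> d"
  shows "x ^ j + real j * x ^ (j - 1) * d \<le> (x + d) ^ j"
proof (induction j)
  case (Suc j)
  have "x ^ Suc j + real (Suc j) * x ^ j * d \<le> (x ^ j + real j * x ^ (j - 1) * d) * (x + d)"
    using assms by (cases j) (auto simp: algebra_simps)
  also have "\<dots> \<le> (x + d) ^ j * (x + d)"
    using Suc assms by (intro mult_right_mono) auto
  finally show ?case by (simp add: mult.commute)
qed simp

section \<open>Probabilities of Breaker's claims\<close>

text \<open>The potential \<open>(1 - s / f)\<^sup>j\<close>, with \<open>f\<close> free edges of the board and \<open>j\<close> edges of \<open>Q\<close> not yet
  claimed by Breaker, dominates the probability that Breaker occupies \<open>Q\<close> before only \<open>s\<close> edges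
  are free: \<open>y = 1 - s / f\<close> and \<open>x = 1 - s / (f - 1)\<close> satisfy \<open>y = x + (1 - x) / f\<close>, so that
  the supermartingale inequality is the tangent line bound for \<open>y\<^sup>j\<close> at \<open>x\<close>.\<close>

lemma prob_breaker_claims_all_le:
  assumes legal: "legal_strategy n \<sigma>" and Q: "Q \<subseteq> complete_edges n"
    and s: "0 < s" "real (t * (b + 1)) + s \<le> real (card (complete_edges n))"
  shows "measure_pmf.prob (half_random_game n b \<sigma> t) {h. Q \<subseteq> claimed_by Breaker h}
    \<le> (1 - s / real (card (complete_edges n))) ^ card Q"
proof -
  define N where "N = card (complete_edges n)"
  define m where "m = t * (b + 1)"
  define y where "y k = 1 - s / (real N - real k)" for k
  \<comment> \<open>The value 0 records that Breaker can no longer own all of \<open>Q\<close> once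
    Maker has an edge of it; this keeps Maker's moves from raising the potential.\<close>
  define \<Phi> where "\<Phi> h = (if Q \<inter> claimed_by Maker h = {}
     then y (length h) ^ card (Q - claimed_by Breaker h) else 0)" for h
  have sm: "real m + s \<le> real N" using s by (simp add: N_def m_def)
  then have mN: "m \<le> N" using s(1) by linarith
  have finQ: "finite Q" using Q finite_subset finite_complete_edges by blast
  have y_nonneg: "0 \<le> y k" if "k \<le> m" for k
    using sm s(1) that by (simp add: y_def divide_simps)
  have y_mono: "y (Suc k) \<le> y k" if "k < m" for k
    using sm s(1) that by (auto simp: y_def intro!: divide_left_mono mult_pos_pos)
  have claim: "(\<integral>\<^sup>+h'. ennreal (\<Phi> h') \<partial>measure_pmf (random_breaker_claim n h)) \<le> ennreal (\<Phi> h)"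
    if h: "valid_history n h" "length h < m" for h
  proof -
    define F where "F = free_edges n h"
    define f where "f = card F"
    define j where "j = card (Q - claimed_by Breaker h)"
    define x where "x = y (Suc (length h))"
    have f: "f + length h = N" using card_free_edges[OF h(1)] by (simp add: f_def F_def N_def)
    then have fN: "real f = real N - real (length h)" by linarith
    have f0: "s < real f" "0 < f" using f sm h(2) s(1) by linarith+
    have x0: "0 \<le> x" using h(2) y_nonneg by (simp add: x_def)
    have xy: "y (length h) = x + (1 - x) / real f" and x1: "x \<le> 1"
    proof -
      have "real (Suc (length h)) + s \<le> real N" using sm h(2) by linarith
      then have "0 < real N - real (length h) - 1" using s(1) by simp
      then show "x \<le> 1" "y (length h) = x + (1 - x) / real f"
        using s(1) unfolding x_def y_def fN by (simp_all add: divide_simps) (simp add: algebra_simps)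
    qed
    have free: "F \<noteq> {}" using f0 by (auto simp: f_def)
    have finF: "finite F" by (simp add: F_def)
    show ?thesis
    proof (cases "Q \<inter> claimed_by Maker h = {}")
      case False
      then have "\<Phi> (h @ [(Breaker, e)]) = 0" for e
        by (simp add: \<Phi>_def claimed_by_append)
      then show ?thesis
        using nn_integral_random_breaker_claim[of n h \<Phi>] free by (simp add: F_def)
    next
      case True
      define J where "J = Q - claimed_by Breaker h"
      have JF: "J \<subseteq> F" using True Q by (auto simp: J_def F_def free_edges_def)
      have jf: "j \<le> f" using card_mono[OF finF JF] by (simp add: j_def f_def J_def)
      have \<Phi>: "\<Phi> (h @ [(Breaker, e)]) = (if e \<in> J then x ^ (j - 1) else x ^ j)" for e
      proof -
        have "Q - (claimed_by Breaker h \<union> {e}) = J - {e}" by (auto simp: J_def)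
        moreover have "card (J - {e}) = (if e \<in> J then j - 1 else j)"
          by (simp add: j_def J_def)
        ultimately show ?thesis
          using True by (simp add: \<Phi>_def claimed_by_append x_def)
      qed
      \<comment> \<open>Of the \<open>f\<close> equally likely edges exactly the \<open>j\<close>
        edges of \<open>J\<close> lower the exponent; the base becomes \<open>x\<close> in either
        case.\<close>
      have "(\<Sum>e\<in>F. \<Phi> (h @ [(Breaker, e)])) = (\<Sum>e\<in>J. x ^ (j - 1)) + (\<Sum>e\<in>F - J. x ^ j)"
        unfolding \<Phi> using finF JF by (subst sum.subset_diff[OF JF finF]) simp
      also have "\<dots> = real j * x ^ (j - 1) + (real f - real j) * x ^ j"
        using finF JF jf finite_subset[OF JF finF]
        by (simp add: card_Diff_subset f_def j_def J_def of_nat_diff)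
      also have "\<dots> = real f * (x ^ j + real j * x ^ (j - 1) * ((1 - x) / real f))"
        using f0 by (cases j) (simp_all add: field_simps)
      also have "\<dots> \<le> real f * y (length h) ^ j"
        unfolding xy using x0 x1 by (intro mult_left_mono power_add_ge_linear) auto
      finally have le: "(\<Sum>e\<in>F. \<Phi> (h @ [(Breaker, e)])) / real f \<le> \<Phi> h"
        using f0 True by (simp add: \<Phi>_def j_def field_simps)
      have nn: "0 \<le> \<Phi> (h @ [(Breaker, e)])" for e using x0 by (simp add: \<Phi>)
      show ?thesis
        using nn_integral_random_breaker_claim[of n h \<Phi>] free le nn f0
        by (simp add: F_def f_def sum_nonneg ennreal_leI divide_ennreal ennreal_of_nat_eq_real_of_nat)
    qed
  qed
  \<comment> \<open>Either Maker owns an edge of \<open>Q\<close> afterwards and the value is 0, or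
    the exponent stays and the base decreases with the number of free edges.\<close>
  have maker: "\<Phi> (h @ [(Maker, e)]) \<le> \<Phi> h" if h: "length h < m" for h e
    using y_nonneg[of "Suc (length h)"] y_nonneg[of "length h"] y_mono[OF h] h
    by (auto simp: \<Phi>_def claimed_by_append intro!: power_mono)
  have "(\<integral>\<^sup>+h. ennreal (\<Phi> h) \<partial>measure_pmf (half_random_game n b \<sigma> t)) \<le> ennreal (\<Phi> [])"
    unfolding half_random_game_eq
    by (rule continued_game_supermartingale[of n m]) (use claim maker mN legal in \<open>auto simp: N_def m_def\<close>)
  then have int: "(\<integral>\<^sup>+h. ennreal (\<Phi> h) \<partial>measure_pmf (half_random_game n b \<sigma> t))
      \<le> ennreal ((1 - s / real N) ^ card Q)"
    by (simp add: \<Phi>_def y_def)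
  have "measure_pmf.prob (half_random_game n b \<sigma> t) {h. Q \<subseteq> claimed_by Breaker h}
      \<le> (1 - s / real N) ^ card Q"
  proof (rule prob_le_nn_integral[OF _ int])
    fix h assume h: "h \<in> set_pmf (half_random_game n b \<sigma> t)" "h \<in> {h. Q \<subseteq> claimed_by Breaker h}"
    then have "valid_history n h"
      using continued_game_valid legal by (auto simp: half_random_game_eq)
    then have "Q \<inter> claimed_by Maker h = {}" "card (Q - claimed_by Breaker h) = 0"
      using h(2) claimed_disjoint by (auto simp: card_eq_0_iff)
    then show "1 \<le> \<Phi> h" unfolding \<Phi>_def by simp
  qed (use y_nonneg[of 0] in \<open>simp add: y_def\<close>)
  then show ?thesis by (simp add: N_def)
qed

text \<open>A union bound: at most \<open>t * (b + 1)\<close> claims follow, Maker's being counted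
  too, and a random one hits \<open>Q\<close> with probability at most \<open>card Q / s\<close>
  while at least \<open>s\<close> edges are free. The potential is \<open>c\<close> times the number
  of claims still to come, replaced by 1 after a hit.\<close>

lemma prob_breaker_hits_le:
  assumes legal: "legal_strategy n \<sigma>" and Q: "finite Q" "Q \<inter> claimed_by Breaker h = {}"
    and h: "valid_history n h"
    and s: "0 < s" "real (length h + t * (b + 1)) + s \<le> real (card (complete_edges n))"
  shows "measure_pmf.prob (continued_game n b \<sigma> t h) {h'. Q \<inter> claimed_by Breaker h' \<noteq> {}}
    \<le> real (card Q) * real (t * (b + 1)) / s"
proof -
  define m where "m = length h + t * (b + 1)"
  define c where "c = real (card Q) / s"
  define \<Phi> where "\<Phi> h = (if Q \<inter> claimed_by Breaker h = {} then c * (real m - real (length h)) else 1)" for h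
  have c0: "0 \<le> c" using s(1) by (simp add: c_def)
  have "real m \<le> real (card (complete_edges n))" using s unfolding m_def by linarith
  then have mN: "m \<le> card (complete_edges n)" by simp
  have claim: "(\<integral>\<^sup>+h'. ennreal (\<Phi> h') \<partial>measure_pmf (random_breaker_claim n h)) \<le> ennreal (\<Phi> h)"
    if h: "valid_history n h" "length h < m" for h
  proof -
    define F where "F = free_edges n h"
    define f where "f = card F"
    have f: "f + length h = card (complete_edges n)"
      using card_free_edges[OF h(1)] by (simp add: f_def F_def)
    have fs: "s \<le> real f" using f h(2) s(2) unfolding m_def by linarith
    then have "0 < f" using s(1) by (cases f) auto
    note fs = fs this
    then have free: "F \<noteq> {}" by (auto simp: f_def)
    have finF: "finite F" by (simp add: F_def)
    have *: "(\<Sum>e\<in>F. \<Phi> (h @ [(Breaker, e)])) \<le> real f * \<Phi> h"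
    proof (cases "Q \<inter> claimed_by Breaker h = {}")
      case False
      then have "\<Phi> (h @ [(Breaker, e)]) = \<Phi> h" for e
        by (auto simp: \<Phi>_def claimed_by_append)
      then show ?thesis by (simp add: f_def)
    next
      case True
      define a where "a = c * (real m - real (length h) - 1)"
      have a0: "0 \<le> a" using h(2) c0 by (simp add: a_def)
      have "(\<Sum>e\<in>F. \<Phi> (h @ [(Breaker, e)])) \<le> (\<Sum>e\<in>F. of_bool (e \<in> Q) + a)"
        using True a0 by (intro sum_mono) (auto simp: \<Phi>_def claimed_by_append a_def diff_diff_eq add.commute)
      also have "\<dots> = real (card (F \<inter> Q)) + real f * a"
        using finF by (simp add: sum.distrib f_def sum_of_bool_eq)
      also have "\<dots> \<le> real (card Q) + real f * a"
        using Q(1) by (simp add: card_mono)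
      \<comment> \<open>Since \<open>s * c = card Q\<close> and \<open>s \<le> f\<close>, the drop
        of the potential by \<open>c\<close> per claim pays for the chance of a hit.\<close>
      also have "\<dots> \<le> real f * c + real f * a"
        using mult_left_mono[OF fs(1), of c] c0 s(1) by (simp add: c_def mult.commute)
      also have "\<dots> = real f * \<Phi> h"
        using True by (simp add: \<Phi>_def a_def algebra_simps)
      finally show ?thesis .
    qed
    have nn: "0 \<le> \<Phi> (h @ [(Breaker, e)])" for e using h(2) c0 by (simp add: \<Phi>_def)
    have "(\<Sum>e\<in>F. \<Phi> (h @ [(Breaker, e)])) / real f \<le> \<Phi> h"
      using * fs(2) by (simp add: field_simps)
    then show ?thesis
      using nn_integral_random_breaker_claim[of n h \<Phi>] free nn fs
      by (simp add: F_def f_def sum_nonneg ennreal_leI divide_ennreal ennreal_of_nat_eq_real_of_nat)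
  qed
  have maker: "\<Phi> (h @ [(Maker, e)]) \<le> \<Phi> h" if h: "length h < m" for h e
    using c0 by (auto simp: \<Phi>_def claimed_by_append intro!: mult_left_mono)
  have "(\<integral>\<^sup>+h. ennreal (\<Phi> h) \<partial>measure_pmf (continued_game n b \<sigma> t h)) \<le> ennreal (\<Phi> h)"
    by (rule continued_game_supermartingale[of n m])
      (use claim maker mN h legal in \<open>auto simp: m_def\<close>)
  also have "\<Phi> h = real (card Q) * real (t * (b + 1)) / s"
    using Q(2) by (simp add: \<Phi>_def c_def m_def)
  finally show ?thesis
    using s(1) by (intro prob_le_nn_integral) (auto simp: \<Phi>_def)
qed

section \<open>Paths and cycles avoiding Breaker's edges\<close>

text \<open>\<open>E\<close> stands for Breaker's graph. The second clause secures a large minimum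
  degree in the complement through events of only \<open>L\<close> edges each: the blocks are
  disjoint, so one neighbour per block adds up. The block of \<open>v\<close> itself is left out
  because there \<open>u = v\<close> would satisfy the condition trivially for a set of
  edges.\<close>

definition expanding :: "nat \<Rightarrow> nat \<Rightarrow> edge set \<Rightarrow> bool" where
  "expanding n L E \<longleftrightarrow>
     (\<forall>A B. A \<subseteq> {..<n} \<and> B \<subseteq> {..<n} \<and> A \<inter> B = {} \<and> card A = L \<and> card B = L \<longrightarrow>
        (\<exists>a\<in>A. \<exists>b\<in>B. {a, b} \<notin> E)) \<and>
     (\<forall>v<n. \<forall>k<n div L. k \<noteq> v div L \<longrightarrow> (\<exists>u\<in>{k * L..<k * L + L}. {v, u} \<notin> E))"

text \<open>Lets one estimate after the last round of the search serve all its rounds.\<close>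

lemma expanding_antimono:
  assumes ex: "expanding n L E" and E': "E' \<subseteq> E"
  shows "expanding n L E'"
  unfolding expanding_def
proof (intro conjI allI impI)
  fix A B assume "A \<subseteq> {..<n} \<and> B \<subseteq> {..<n} \<and> A \<inter> B = {} \<and> card A = L \<and> card B = L"
  then have "\<exists>a\<in>A. \<exists>b\<in>B. {a, b} \<notin> E"
    by (rule ex[unfolded expanding_def, THEN conjunct1, rule_format])
  then show "\<exists>a\<in>A. \<exists>b\<in>B. {a, b} \<notin> E'" using E' by (meson subsetD)
next
  fix v k assume "v < n" "k < n div L" "k \<noteq> v div L"
  then have "\<exists>u\<in>{k * L..<k * L + L}. {v, u} \<notin> E"
    by (rule ex[unfolded expanding_def, THEN conjunct2, rule_format])
  then show "\<exists>u\<in>{k * L..<k * L + L}. {v, u} \<notin> E'" using E' by (meson subsetD)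
qed

lemma expanding_pair:
  assumes "expanding n L E" "A \<subseteq> {..<n}" "B \<subseteq> {..<n}" "A \<inter> B = {}" "L \<le> card A" "L \<le> card B"
  obtains a b where "a \<in> A" "b \<in> B" "{a, b} \<notin> E"
proof -
  obtain A' B' where "A' \<subseteq> A" "card A' = L" "B' \<subseteq> B" "card B' = L"
    using assms(5,6) obtain_subset_with_card_n by metis
  moreover from this have "A' \<subseteq> {..<n}" "B' \<subseteq> {..<n}" "A' \<inter> B' = {}"
    using assms(2-4) by auto
  ultimately obtain a b where "a \<in> A'" "b \<in> B'" "{a, b} \<notin> E"
    using assms(1) unfolding expanding_def by blast
  then show ?thesis using that \<open>A' \<subseteq> A\<close> \<open>B' \<subseteq> B\<close> by blast
qed

text \<open>The map sending \<open>u\<close> to \<open>u div L\<close> takes the neighbours of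
  \<open>v\<close> outside \<open>E\<close> to a set that covers all full blocks other than that of
  \<open>v\<close>.\<close>

lemma expanding_degree:
  assumes ex: "expanding n L E" and v: "v < n" and L: "0 < L"
  shows "n div L - 1 \<le> card {u. u < n \<and> u \<noteq> v \<and> {v, u} \<notin> E}"
proof -
  let ?N = "{u. u < n \<and> u \<noteq> v \<and> {v, u} \<notin> E}"
  have "{..<n div L} - {v div L} \<subseteq> (\<lambda>u. u div L) ` ?N"
  proof
    fix k assume k: "k \<in> {..<n div L} - {v div L}"
    then obtain u where u: "k * L \<le> u" "u < k * L + L" "{v, u} \<notin> E"
      using ex v unfolding expanding_def by force
    have uk: "u div L = k"
      using u L by (intro div_nat_eqI) (auto simp: mult.commute)
    have "Suc k * L \<le> (n div L) * L" using k by (intro mult_right_mono) auto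
    also have "\<dots> \<le> n" by simp
    finally have "u < n" using u by simp
    moreover have "u \<noteq> v" using uk k by auto
    ultimately show "k \<in> (\<lambda>u. u div L) ` ?N" using uk u by blast
  qed
  then have "card ({..<n div L} - {v div L}) \<le> card ?N"
    by (rule surj_card_le[rotated]) simp
  moreover have "n div L - 1 \<le> card ({..<n div L} - {v div L})"
    by (simp add: card_Diff_singleton_if)
  ultimately show ?thesis by linarith
qed

section \<open>Paths as vertex lists, absorption and closing\<close>

fun path_edges :: "nat list \<Rightarrow> edge set" where
  "path_edges (x # y # zs) = insert {x, y} (path_edges (y # zs))"
| "path_edges _ = {}"

lemma finite_path_edges [simp]: "finite (path_edges xs)"
  by (induction xs rule: path_edges.induct) auto

lemma path_edges_Cons: "xs \<noteq> [] \<Longrightarrow> path_edges (x # xs) = insert {x, hd xs} (path_edges xs)"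
  by (cases xs) auto

lemma path_edges_append:
  "xs \<noteq> [] \<Longrightarrow> ys \<noteq> [] \<Longrightarrow>
    path_edges (xs @ ys) = insert {last xs, hd ys} (path_edges xs \<union> path_edges ys)"
  by (induction xs rule: path_edges.induct) (auto simp: path_edges_Cons)

lemma path_edges_rev: "path_edges (rev xs) = path_edges xs"
  by (induction xs rule: path_edges.induct)
    (auto simp: path_edges_append insert_commute simp flip: append_assoc)

lemma path_edges_conv_nth: "path_edges xs = {{xs ! i, xs ! Suc i} |i. Suc i < length xs}"
proof (induction xs rule: path_edges.induct)
  case (1 x y zs)
  have "{{(x # y # zs) ! i, (x # y # zs) ! Suc i} |i. Suc i < length (x # y # zs)} =
    insert {x, y} {{(y # zs) ! i, (y # zs) ! Suc i} |i. Suc i < length (y # zs)}" (is "?l = insert _ ?r")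
  proof (intro set_eqI iffI)
    fix e assume "e \<in> ?l"
    then obtain i where "e = {(x # y # zs) ! i, (x # y # zs) ! Suc i}" "Suc i < length (x # y # zs)"
      by blast
    then show "e \<in> insert {x, y} ?r" by (cases i) auto
  next
    fix e assume "e \<in> insert {x, y} ?r"
    then show "e \<in> ?l"
    proof
      assume "e = {x, y}"
      then show ?thesis by (force intro: exI[of _ 0])
    next
      assume "e \<in> ?r"
      then obtain i where "e = {(y # zs) ! i, (y # zs) ! Suc i}" "Suc i < length (y # zs)" by blast
      then show ?thesis by (force intro: exI[of _ "Suc i"])
    qed
  qed
  with 1 show ?case by simp
qed auto

text \<open>The vertex \<open>w\<close> has many neighbours on the path, hence two of them, \<open>xs ! i\<close> and \<open>xs ! j\<close>, have
  adjacent successors. Writing the path as \<open>P @ S @ R\<close>, where \<open>P\<close> ends in \<open>xs ! i\<close> and \<open>S\<close> in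
  \<open>xs ! j\<close>, the new path is \<open>P @ [w] @ rev S @ R\<close>.\<close>

lemma absorb_vertex:
  assumes ex: "expanding n L E" and L: "0 < L" and n: "6 * L + 2 \<le> n div L"
    and xs: "distinct xs" "set xs \<subseteq> {..<n}" "n \<le> length xs + 4 * L" "path_edges xs \<inter> E = {}"
    and w: "w < n" "w \<notin> set xs"
  obtains ys where "distinct ys" "set ys = insert w (set xs)" "hd ys = hd xs" "last ys = last xs"
    "path_edges ys \<inter> E = {}" "card (path_edges ys - M) \<le> card (path_edges xs - M) + 3"
proof -
  define I where "I = {i. Suc i < length xs \<and> {w, xs ! i} \<notin> E}"
  have finI: "finite I" unfolding I_def by (rule finite_subset[of _ "{..<length xs}"]) auto
  \<comment> \<open>A neighbour of \<open>w\<close> lies off the path, or is its last vertex, which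
    has no successor, or sits at a position in \<open>I\<close>.\<close>
  have "{u. u < n \<and> u \<noteq> w \<and> {w, u} \<notin> E} \<subseteq> ({..<n} - set xs) \<union> {last xs} \<union> (!) xs ` I"
  proof
    fix u assume u: "u \<in> {u. u < n \<and> u \<noteq> w \<and> {w, u} \<notin> E}"
    show "u \<in> ({..<n} - set xs) \<union> {last xs} \<union> (!) xs ` I"
    proof (cases "u \<in> set xs")
      case True
      then obtain i where i: "i < length xs" "u = xs ! i" by (auto simp: in_set_conv_nth)
      show ?thesis
      proof (cases "Suc i < length xs")
        case False
        then have "i = length xs - 1" using i by simp
        then have "u = last xs" using i by (subst last_conv_nth) auto
          then show ?thesis by simp
      qed (use i u in \<open>auto simp: I_def\<close>)
    qed (use u in auto)
  qed
  then have "card {u. u < n \<and> u \<noteq> w \<and> {w, u} \<notin> E} \<le> card (({..<n} - set xs) \<union> {last xs} \<union> (!) xs ` I)"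
    using finI by (intro card_mono) auto
  also have "\<dots> \<le> card ({..<n} - set xs) + 1 + card I"
    using card_Un_le[of "({..<n} - set xs) \<union> {last xs}" "(!) xs ` I"]
      card_Un_le[of "{..<n} - set xs" "{last xs}"] card_image_le[OF finI, of "(!) xs"] by simp
  also have "card ({..<n} - set xs) \<le> 4 * L"
    using xs by (simp add: card_Diff_subset distinct_card)
  \<comment> \<open>Origin of the bound \<open>6 * L + 2 \<le> n div L\<close>: of at least
    \<open>6 * L + 1\<close> neighbours at most \<open>4 * L\<close> are off the path and one is its
    last vertex.\<close>
  finally have "2 * L \<le> card I"
    using expanding_degree[OF ex w(1) L] n by simp
  then obtain I1 where I1: "I1 \<subseteq> I" "card I1 = L"
    using obtain_subset_with_card_n[of L I] by auto
  have I2: "L \<le> card (I - I1)"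
    using I1 \<open>2 * L \<le> card I\<close> finI by (simp add: card_Diff_subset finite_subset)
  \<comment> \<open>The two parts of \<open>I\<close> have at least \<open>L\<close> elements each,
    so they give two disjoint sets of successors between which \<open>E\<close> misses a
    pair.\<close>
  define f where "f i = xs ! Suc i" for i
  have inj: "inj_on f I"
    using xs(1) by (auto simp: f_def I_def inj_on_def nth_eq_iff_index_eq)
  have sub: "f ` I \<subseteq> {..<n}"
    using xs(2) by (force simp: f_def I_def dest: nth_mem)
  obtain a c where ac: "a \<in> f ` I1" "c \<in> f ` (I - I1)" "{a, c} \<notin> E"
  proof (rule expanding_pair[OF ex])
    show "f ` I1 \<subseteq> {..<n}" "f ` (I - I1) \<subseteq> {..<n}" using sub I1 by auto
    show "f ` I1 \<inter> f ` (I - I1) = {}" using inj I1(1) by (auto simp: inj_on_def)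
    show "L \<le> card (f ` I1)" "L \<le> card (f ` (I - I1))"
      using inj I1 I2 by (auto simp: card_image inj_on_subset inj_on_diff)
  qed
  then obtain i0 j0 where "i0 \<in> I" "j0 \<in> I" "i0 \<noteq> j0" "{f i0, f j0} \<notin> E"
    using I1(1) by auto
  then obtain i j where ij: "i \<in> I" "j \<in> I" "i < j" "{f i, f j} \<notin> E"
    by (metis insert_commute linorder_neqE_nat)
  define P S R where "P = take (Suc i) xs" and "S = take (j - i) (drop (Suc i) xs)" and "R = drop (Suc j) xs"
  have jl: "Suc j < length xs" using ij by (simp add: I_def)
  have xs_eq: "xs = P @ S @ R"
  proof -
    have "S @ R = drop (Suc i) xs"
      using append_take_drop_id[of "j - i" "drop (Suc i) xs"] ij(3) by (simp add: S_def R_def)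
    then show ?thesis by (simp add: P_def)
  qed
  have ne: "P \<noteq> []" "S \<noteq> []" "R \<noteq> []" using ij(3) jl by (auto simp: P_def S_def R_def)
  have ends: "last P = xs ! i" "hd S = xs ! Suc i" "last S = xs ! j" "hd R = xs ! Suc j"
    using ij(3) jl ne by (simp_all add: P_def S_def R_def hd_conv_nth last_conv_nth hd_drop_conv_nth)
  define ys where "ys = P @ [w] @ rev S @ R"
  have pxs: "path_edges P \<union> path_edges S \<union> path_edges R \<subseteq> path_edges xs"
    using ne by (auto simp: xs_eq path_edges_append)
  \<comment> \<open>The junctions of \<open>ys\<close> are \<open>xs ! i\<close> to
    \<open>w\<close>, \<open>w\<close> to \<open>xs ! j\<close>, and \<open>f i\<close> to
    \<open>f j\<close>; reversing \<open>S\<close> keeps its edges.\<close>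
  have pys: "path_edges ys \<subseteq> path_edges P \<union> path_edges S \<union> path_edges R \<union>
      {{w, xs ! i}, {w, xs ! j}, {f i, f j}}"
    using ne ends by (simp add: ys_def path_edges_append path_edges_Cons path_edges_rev f_def
        hd_rev last_rev insert_commute) blast
  show ?thesis
  proof
    show "distinct ys" using xs(1) w(2) by (auto simp: ys_def xs_eq)
    show "set ys = insert w (set xs)" by (auto simp: ys_def xs_eq)
    show "hd ys = hd xs" "last ys = last xs" using ne by (simp_all add: ys_def xs_eq)
    show "path_edges ys \<inter> E = {}"
      using pys pxs xs(4) ij unfolding I_def by blast
    have "path_edges ys - M \<subseteq> (path_edges xs - M) \<union> {{w, xs ! i}, {w, xs ! j}, {f i, f j}}"
      using pys pxs by blast
    then have "card (path_edges ys - M) \<le> card ((path_edges xs - M) \<union> {{w, xs ! i}, {w, xs ! j}, {f i, f j}})"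
      by (intro card_mono) auto
    also have "\<dots> \<le> card (path_edges xs - M) + card {{w, xs ! i}, {w, xs ! j}, {f i, f j}}"
      by (rule card_Un_le)
    also have "card {{w, xs ! i}, {w, xs ! j}, {f i, f j}} \<le> 3"
      using card_length[of "[{w, xs ! i}, {w, xs ! j}, {f i, f j}]"] by simp
    finally show "card (path_edges ys - M) \<le> card (path_edges xs - M) + 3" by simp
  qed
qed

text \<open>Absorption keeps both ends, so an edge chosen beforehand to close the path still closes
  the final one, and a growing path keeps missing at most \<open>4 * L\<close> vertices.
  \<open>M\<close> will be Maker's graph: the edges outside it are those still to be
  claimed.\<close>

lemma absorb_all:
  assumes ex: "expanding n L E" and L: "0 < L" and n: "6 * L + 2 \<le> n div L"
    and "distinct xs" "set xs \<subseteq> {..<n}" "n \<le> length xs + 4 * L" "path_edges xs \<inter> E = {}"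
  shows "\<exists>ys. distinct ys \<and> set ys = {..<n} \<and> hd ys = hd xs \<and> last ys = last xs \<and>
    path_edges ys \<inter> E = {} \<and> card (path_edges ys - M) \<le> card (path_edges xs - M) + 3 * (n - length xs)"
  using assms(4-)
proof (induction "n - length xs" arbitrary: xs)
  case 0
  then have "card {..<n} \<le> card (set xs)" by (simp add: distinct_card)
  then have "set xs = {..<n}" using 0 by (intro card_seteq) auto
  then show ?case using 0 by auto
next
  case (Suc k)
  then have "card (set xs) < card {..<n}" by (simp add: distinct_card)
  then obtain w where w: "w < n" "w \<notin> set xs"
    using card_mono[of "set xs" "{..<n}"] by fastforce
  obtain zs where zs: "distinct zs" "set zs = insert w (set xs)" "hd zs = hd xs" "last zs = last xs"
    "path_edges zs \<inter> E = {}" "card (path_edges zs - M) \<le> card (path_edges xs - M) + 3"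
    using absorb_vertex[OF ex L n Suc.prems w] .
  have len: "length zs = Suc (length xs)"
    using zs(1,2) w Suc.prems(1) by (metis distinct_card card_insert_disjoint List.finite_set)
  have "\<exists>ys. distinct ys \<and> set ys = {..<n} \<and> hd ys = hd zs \<and> last ys = last zs \<and>
    path_edges ys \<inter> E = {} \<and> card (path_edges ys - M) \<le> card (path_edges zs - M) + 3 * (n - length zs)"
    by (rule Suc.hyps(1)) (use Suc.hyps(2) Suc.prems zs w len in auto)
  then obtain ys where ys: "distinct ys" "set ys = {..<n}" "hd ys = hd zs" "last ys = last zs"
    "path_edges ys \<inter> E = {}" "card (path_edges ys - M) \<le> card (path_edges zs - M) + 3 * (n - length zs)"
    by blast
  have "card (path_edges ys - M) \<le> card (path_edges xs - M) + 3 * (n - length xs)"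
    using ys(6) zs(6) len Suc.hyps(2) by simp
  then show ?case using ys zs(3,4) by (intro exI[of _ ys]) simp
qed

lemma hamilton_cycle_closed_path:
  assumes "distinct ys" "set ys = {..<n}" "3 \<le> n"
  shows "hamilton_cycle n (insert {last ys, hd ys} (path_edges ys))"
proof -
  have len: "length ys = n" using assms distinct_card[of ys] by simp
  have "insert {last ys, hd ys} (path_edges ys) = {{ys ! i, ys ! (Suc i mod n)} |i. i < n}" (is "?l = ?r")
  proof (intro set_eqI iffI)
    fix e assume "e \<in> ?l"
    then consider "e = {last ys, hd ys}" | i where "Suc i < n" "e = {ys ! i, ys ! Suc i}"
      by (auto simp: path_edges_conv_nth len)
    then show "e \<in> ?r"
    proof cases
      case 1
      then have "e = {ys ! (n - 1), ys ! (Suc (n - 1) mod n)}"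
        using len assms(3) by (cases ys) (auto simp: last_conv_nth hd_conv_nth)
      then show ?thesis using assms(3) by (intro CollectI exI[of _ "n - 1"]) auto
    next
      case 2
      then show ?thesis by (intro CollectI exI[of _ i]) auto
    qed
  next
    fix e assume "e \<in> ?r"
    then obtain i where i: "i < n" "e = {ys ! i, ys ! (Suc i mod n)}" by blast
    show "e \<in> ?l"
    proof (cases "Suc i < n")
      case True
      then show ?thesis using i by (auto simp: path_edges_conv_nth len)
    next
      case False
      then have "Suc i = n" using i by simp
      moreover have "ys \<noteq> []" using len assms(3) by auto
      ultimately show ?thesis using i len by (auto simp: last_conv_nth hd_conv_nth)
    qed
  qed
  then show ?thesis unfolding hamilton_cycle_def using assms by blast
qed

lemma hamilton_completion:
  assumes ex: "expanding n L E" and L: "0 < L" and n: "6 * L + 2 \<le> n div L"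
    and xs: "distinct xs" "set xs \<subseteq> {..<n}" "n \<le> length xs + 2 * L" "path_edges xs \<subseteq> M"
    and M: "M \<inter> E = {}"
  shows "\<exists>Q. finite Q \<and> card Q \<le> 12 * L + 1 \<and> Q \<inter> E = {} \<and> hamiltonicity_game n (M \<union> Q)"
proof -
  have nL: "6 * L + 2 \<le> n" using n L by (meson div_le_dividend le_trans)
  define l where "l = length xs"
  define A B where "A = set (take L xs)" and "B = set (drop (l - L) xs)"
  have lL: "2 * L \<le> l" using nL xs(3) by (simp add: l_def)
  obtain x y where xy: "x \<in> A" "y \<in> B" "{x, y} \<notin> E"
  proof (rule expanding_pair[OF ex])
    show "A \<subseteq> {..<n}" "B \<subseteq> {..<n}"
      using xs(2) set_take_subset[of L xs] set_drop_subset[of "l - L" xs] by (auto simp: A_def B_def)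
    show "A \<inter> B = {}"
      using xs(1) lL unfolding A_def B_def by (intro set_take_disj_set_drop_if_distinct) auto
    show "L \<le> card A" "L \<le> card B"
      using xs(1) lL by (simp_all add: A_def B_def distinct_card l_def)
  qed
  obtain i where i: "i < L" "x = xs ! i" using xy(1) by (auto simp: A_def in_set_conv_nth)
  obtain j where j: "l - L \<le> j" "j < l" "y = xs ! j"
    
  proof -
    obtain k where "k < L" "y = drop (l - L) xs ! k"
      using xy(2) lL by (auto simp: B_def in_set_conv_nth l_def)
    then show ?thesis using lL by (intro that[of "l - L + k"]) (auto simp: l_def)
  qed
  have ij: "i < j" using i j lL by linarith
  \<comment> \<open>Cutting the path at \<open>x\<close> and \<open>y\<close>, whose joining edge is
    not in \<open>E\<close>, loses fewer than \<open>L\<close> vertices at each end; with the at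
    most \<open>2 * L\<close> already missing this stays below \<open>4 * L\<close>.\<close>
  define zs where "zs = take (Suc j - i) (drop i xs)"
  have zl: "length zs = Suc j - i" using ij j by (simp add: zs_def l_def)
  have z: "hd zs = x" "last zs = y"
    using ij i j zl by (simp_all add: zs_def hd_conv_nth last_conv_nth l_def hd_drop_conv_nth)
  have "path_edges zs \<subseteq> path_edges xs"
  proof
    fix e assume "e \<in> path_edges zs"
    then obtain k where "Suc k < length zs" "e = {zs ! k, zs ! Suc k}"
      by (auto simp: path_edges_conv_nth)
    moreover from this have "Suc (i + k) < length xs" using zl j ij by (simp add: l_def)
    ultimately show "e \<in> path_edges xs"
      using zl by (auto simp: path_edges_conv_nth zs_def intro!: exI[of _ "i + k"])
  qed
  then have zM: "path_edges zs \<subseteq> M" using xs by blast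
  have "distinct zs" "set zs \<subseteq> {..<n}"
    using xs(1,2) set_take_subset set_drop_subset unfolding zs_def by (auto, fastforce)
  moreover have "n \<le> length zs + 4 * L" using zl i j xs(3) lL by (simp add: l_def)
  ultimately obtain ys where ys: "distinct ys" "set ys = {..<n}" "hd ys = x" "last ys = y"
    "path_edges ys \<inter> E = {}" "card (path_edges ys - M) \<le> card (path_edges zs - M) + 3 * (n - length zs)"
    using absorb_all[OF ex L n, of zs M] zM M z by auto
  define C where "C = insert {last ys, hd ys} (path_edges ys)"
  have C: "hamilton_cycle n C"
    unfolding C_def by (rule hamilton_cycle_closed_path) (use ys nL L in auto)
  have "card (path_edges zs - M) = 0" using zM by (simp add: card_eq_0_iff)
  then have "card (path_edges ys - M) \<le> 12 * L"
    using ys(6) \<open>n \<le> length zs + 4 * L\<close> by linarith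
  moreover have "C - M \<subseteq> insert {last ys, hd ys} (path_edges ys - M)" by (auto simp: C_def)
  then have "card (C - M) \<le> card (insert {last ys, hd ys} (path_edges ys - M))"
    by (intro card_mono) auto
  moreover have "card (insert {last ys, hd ys} (path_edges ys - M)) \<le> Suc (card (path_edges ys - M))"
    by (rule card_insert_le_m1) auto
  ultimately have "card (C - M) \<le> 12 * L + 1" by linarith
  moreover have "(C - M) \<inter> E = {}" using ys xy by (auto simp: C_def insert_commute)
  moreover have "finite (C - M)" by (simp add: C_def)
  moreover have "hamiltonicity_game n (M \<union> (C - M))"
    unfolding hamiltonicity_game_def using C by blast
  ultimately show ?thesis by (intro exI[of _ "C - M"] conjI)
qed

text \<open>A state of depth-first search after \<open>k\<close> rounds, with stack \<open>xs\<close>, processed vertices \<open>D\<close> and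
  unvisited vertices \<open>U\<close>. Each round visits a new vertex until \<open>U\<close> has shrunk to \<open>L\<close> vertices.\<close>

definition dfs_state :: "nat \<Rightarrow> nat \<Rightarrow> edge set \<Rightarrow> edge set \<Rightarrow> nat \<Rightarrow> bool" where
  "dfs_state n L E M k \<longleftrightarrow> (\<exists>xs D U. distinct xs \<and> path_edges xs \<subseteq> M \<and>
     set xs \<union> D \<union> U = {..<n} \<and> set xs \<inter> D = {} \<and> set xs \<inter> U = {} \<and> D \<inter> U = {} \<and>
     (\<forall>d\<in>D. \<forall>u\<in>U. {d, u} \<in> E) \<and> L \<le> card U \<and> (card U = L \<or> card U + k < n))"

text \<open>Breaker's replies do no harm: pairs between \<open>D\<close> and \<open>U\<close> are
  required to lie in \<open>E\<close> and path edges in \<open>M\<close>, and both graphs only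
  grow.\<close>

lemma dfs_state_mono:
  assumes "dfs_state n L E M k" "E \<subseteq> E'" "M \<subseteq> M'"
  shows "dfs_state n L E' M' k"
proof -
  obtain xs D U where g: "distinct xs \<and> path_edges xs \<subseteq> M \<and>
     set xs \<union> D \<union> U = {..<n} \<and> set xs \<inter> D = {} \<and> set xs \<inter> U = {} \<and> D \<inter> U = {} \<and>
     (\<forall>d\<in>D. \<forall>u\<in>U. {d, u} \<in> E) \<and> L \<le> card U \<and> (card U = L \<or> card U + k < n)"
    using assms(1) unfolding dfs_state_def by (elim exE) (rule that)
  have "path_edges xs \<subseteq> M'" "\<forall>d\<in>D. \<forall>u\<in>U. {d, u} \<in> E'"
    using g assms(2,3) by (auto dest: subsetD)
  with g show ?thesis
    unfolding dfs_state_def by (intro exI[of _ xs] exI[of _ D] exI[of _ U]) simp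
qed

text \<open>The root is visited without an edge; hence the strict inequality
  \<open>card U + k < n\<close> in the state.\<close>

lemma dfs_state_init:
  assumes "L < n"
  shows "dfs_state n L E {} 0"
proof -
  have "card {1..<n} = n - 1" by simp
  then show ?thesis
    unfolding dfs_state_def using assms
    by (intro exI[of _ "[0]"] exI[of _ "{}"] exI[of _ "{1..<n}"]) auto
qed

text \<open>Backtracking and steps along edges that Maker already owns cost no move. They are
  carried out until a free edge from the top of the stack to an unvisited vertex turns up, or
  \<open>U\<close> has \<open>L\<close> vertices and any free edge will do.\<close>

lemma dfs_state_step:
  assumes ex: "expanding n L E" and L: "0 < L" "L < n div L"
    and F: "F = complete_edges n - (M \<union> E)" "F \<noteq> {}"
    and st: "dfs_state n L E M k"
  shows "\<exists>e\<in>F. dfs_state n L E (insert e M) (Suc k)"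
proof -
  define good where "good xs D U \<longleftrightarrow> distinct xs \<and> path_edges xs \<subseteq> M \<and>
     set xs \<union> D \<union> U = {..<n} \<and> set xs \<inter> D = {} \<and> set xs \<inter> U = {} \<and> D \<inter> U = {} \<and>
     (\<forall>d\<in>D. \<forall>u\<in>U. {d, u} \<in> E) \<and> L \<le> card U \<and> (card U = L \<or> card U + k < n)" for xs D U
  have "\<exists>e\<in>F. dfs_state n L E (insert e M) (Suc k)" if "good xs D U" for xs D U
    using that
  \<comment> \<open>A visit lowers \<open>card U\<close> by one and lengthens the stack by one,
    backtracking shortens the stack: the weight 2 makes both decrease the measure.\<close>
  proof (induction "2 * card U + length xs" arbitrary: xs D U rule: less_induct)
    case less
    note g = less.prems[unfolded good_def]
    have finU: "finite U" and finD: "finite D" using g by (metis finite_Un finite_lessThan)+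
    obtain e0 where e0: "e0 \<in> F" using F by blast
    have "card U = L \<or> L < card U \<and> card U + k < n" using g by linarith
    then consider (stop) "card U = L" | (root) "L < card U" "card U + k < n" "xs = []"
      | (stack) v vs where "L < card U" "card U + k < n" "xs = v # vs"
      using neq_Nil_conv[of xs] by blast
    then show ?case
    proof cases
      case stop
      then have "dfs_state n L E (insert e0 M) (Suc k)"
        unfolding dfs_state_def using g by (intro exI[of _ xs] exI[of _ D] exI[of _ U]) auto
      then show ?thesis using e0 by blast
    next
      case root
      \<comment> \<open>An empty stack is impossible: \<open>D\<close> is nonempty since
        \<open>card U < n\<close> and has fewer than \<open>L\<close> vertices by expansion, yet it
        contains all neighbours outside \<open>E\<close> of each of its vertices, at least
        \<open>n div L - 1 \<ge> L\<close> many.\<close>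
      have "card D < L"
      proof (rule ccontr)
        assume "\<not> card D < L"
        then obtain a c where "a \<in> D" "c \<in> U" "{a, c} \<notin> E"
          using expanding_pair[OF ex, of D U] g root by auto
        then show False using g by blast
      qed
      moreover have "D \<noteq> {}" using g root by (metis Un_empty_left card_lessThan list.set(1) not_add_less1)
      then obtain d where d: "d \<in> D" by blast
      have "{u. u < n \<and> u \<noteq> d \<and> {d, u} \<notin> E} \<subseteq> D"
        using g root d by (auto simp: set_eq_iff)
      then have "card {u. u < n \<and> u \<noteq> d \<and> {d, u} \<notin> E} \<le> card D"
        using finD by (rule card_mono[rotated])
      moreover have "d < n" using d g by auto
      ultimately show ?thesis using expanding_degree[OF ex _ L(1), of d] L(2) by simp
    next
      case stack
      show ?thesis
      proof (cases "\<exists>u\<in>U. {v, u} \<notin> E")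
        case True
        then obtain u where u: "u \<in> U" "{v, u} \<notin> E" by blast
        have cU: "card (U - {u}) = card U - 1" using u finU by simp
        have c: "L \<le> card (U - {u})" "card (U - {u}) = L \<or> card (U - {u}) + Suc k < n"
          "card (U - {u}) = L \<or> card (U - {u}) + k < n"
          using cU stack by linarith+
        have ext: "distinct (u # xs)" "path_edges (u # xs) \<subseteq> insert {v, u} M"
          "set (u # xs) \<union> D \<union> (U - {u}) = {..<n}" "set (u # xs) \<inter> D = {}" "set (u # xs) \<inter> (U - {u}) = {}"
          "D \<inter> (U - {u}) = {}" "\<forall>d\<in>D. \<forall>u\<in>U - {u}. {d, u} \<in> E"
          using g u stack by (auto simp: insert_commute)
        show ?thesis
        proof (cases "{v, u} \<in> M")
          case True
          then have "insert {v, u} M = M" by blast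
          then have "good (u # xs) D (U - {u})"
            unfolding good_def using ext c by simp
          then show ?thesis using less.hyps[of "U - {u}" "u # xs" D] cU stack by auto
        next
          case False
          have "v < n" "u < n" "v \<noteq> u" using g u stack by auto
          then have "{v, u} \<in> F" using False u by (simp add: F complete_edges_def)
          moreover have "dfs_state n L E (insert {v, u} M) (Suc k)"
            unfolding dfs_state_def using ext c
            by (intro exI[of _ "u # xs"] exI[of _ D] exI[of _ "U - {u}"]) simp
          ultimately show ?thesis by (rule bexI[rotated])
        qed
      next
        case False
        have "path_edges vs \<subseteq> path_edges xs" using stack by (cases vs) auto
        then have "good vs (insert v D) U"
          unfolding good_def using g stack False by auto
        then show ?thesis using less.hyps[of U vs "insert v D"] stack by auto
      qed
    qed
  qed
  moreover obtain xs D U where "good xs D U"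
    using st[unfolded dfs_state_def, folded good_def] by (elim exE) (rule that)
  ultimately show ?thesis .
qed

text \<open>For \<open>k = n\<close> the alternative \<open>card U + k < n\<close> fails, so
  \<open>card U = L\<close>, and expansion then leaves fewer than \<open>L\<close> vertices to
  \<open>D\<close>.\<close>

lemma dfs_state_final:
  assumes ex: "expanding n L E" and st: "dfs_state n L E M n"
  obtains xs where "distinct xs" "set xs \<subseteq> {..<n}" "path_edges xs \<subseteq> M" "n \<le> length xs + 2 * L"
proof -
  obtain xs D U where g: "distinct xs" "path_edges xs \<subseteq> M"
     "set xs \<union> D \<union> U = {..<n}" "D \<inter> U = {}"
     "\<forall>d\<in>D. \<forall>u\<in>U. {d, u} \<in> E" "card U = L"
    using st unfolding dfs_state_def by auto
  have "card D < L"
  proof (rule ccontr)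
    assume "\<not> card D < L"
    then obtain a c where "a \<in> D" "c \<in> U" "{a, c} \<notin> E"
      using expanding_pair[OF ex, of D U] g by auto
    then show False using g by blast
  qed
  moreover have "n \<le> card (set xs) + card D + card U"
    using card_Un_le[of "set xs \<union> D" U] card_Un_le[of "set xs" D] g(3) by simp
  ultimately have "n \<le> length xs + 2 * L" using g by (simp add: distinct_card)
  then show ?thesis using that g by auto
qed

section \<open>Winning requires many edges\<close>

lemma hamilton_cycle_subset_complete_edges:
  assumes "hamilton_cycle n C"
  shows "C \<subseteq> complete_edges n"
proof -
  obtain xs where xs: "distinct xs" "set xs = {..<n}" "3 \<le> n"
    "C = {{xs ! i, xs ! (Suc i mod n)} |i. i < n}"
    using assms unfolding hamilton_cycle_def by blast
  have len: "length xs = n" using xs distinct_card[of xs] by simp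
  have "{xs ! i, xs ! (Suc i mod n)} \<in> complete_edges n" if "i < n" for i
  proof (rule pair_in_complete_edges)
    have j: "Suc i mod n < n" using xs(3) by simp
    show "xs ! i < n" "xs ! (Suc i mod n) < n"
      using nth_mem[of i xs] nth_mem[of "Suc i mod n" xs] j that len xs(2) by auto
    have "i \<noteq> Suc i mod n" using that xs(3) by (cases "Suc i = n") auto
    then show "xs ! i \<noteq> xs ! (Suc i mod n)"
      using xs(1) that len j by (simp add: nth_eq_iff_index_eq)
  qed
  then show ?thesis using xs(4) by auto
qed

lemma hamilton_imp_connected:
  assumes "hamiltonicity_game n E"
  shows "connectivity_game n E"
  unfolding connectivity_game_def
proof (intro allI impI)
  let ?R = "{(x, y). {x, y} \<in> E}"
  obtain xs where xs: "distinct xs" "set xs = {..<n}" "3 \<le> n"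
    "{{xs ! i, xs ! (Suc i mod n)} |i. i < n} \<subseteq> E"
    using assms unfolding hamiltonicity_game_def hamilton_cycle_def by blast
  have len: "length xs = n" using xs distinct_card[of xs] by simp
  have reach: "(xs ! i, xs ! ((i + k) mod n)) \<in> ?R\<^sup>*" if "i < n" for i k
  proof (induction k)
    case (Suc k)
    have "{xs ! ((i + k) mod n), xs ! (Suc ((i + k) mod n) mod n)} \<in> E"
      using xs(3) by (intro subsetD[OF xs(4)] CollectI exI[of _ "(i + k) mod n"]) auto
    then have "(xs ! ((i + k) mod n), xs ! ((i + Suc k) mod n)) \<in> ?R"
      by (simp add: mod_Suc_eq)
    with Suc show ?case by (rule rtrancl.rtrancl_into_rtrancl)
  qed (use that in simp)
  fix u v assume "u < n" "v < n"
  then obtain i j where "i < n" "u = xs ! i" "j < n" "v = xs ! j"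
    using xs(2) len by (metis in_set_conv_nth lessThan_iff)
  \<comment> \<open>Adding \<open>n\<close> before subtracting \<open>i\<close> avoids truncation;
    the extra turn around the cycle vanishes modulo \<open>n\<close>.\<close>
  then show "(u, v) \<in> ?R\<^sup>*" using reach[of i "j + n - i"] by simp
qed

lemma hamilton_imp_min_degree_2:
  assumes "hamiltonicity_game n E" "finite E"
  shows "min_degree_2_game n E"
  unfolding min_degree_2_game_def
proof (intro allI impI)
  obtain xs where xs: "distinct xs" "set xs = {..<n}" "3 \<le> n"
    "{{xs ! i, xs ! (Suc i mod n)} |i. i < n} \<subseteq> E"
    using assms unfolding hamiltonicity_game_def hamilton_cycle_def by blast
  have len: "length xs = n" using xs distinct_card[of xs] by simp
  fix v assume "v < n"
  then obtain i where i: "i < n" "v = xs ! i"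
    using xs(2) len by (metis in_set_conv_nth lessThan_iff)
  \<comment> \<open>Predecessor and successor on the cycle; they differ because
    \<open>3 \<le> n\<close>.\<close>
  define j where "j = (if i = 0 then n - 1 else i - 1)"
  define k where "k = Suc i mod n"
  have jk: "j < n" "k < n" "Suc j mod n = i" "j \<noteq> k" "j \<noteq> i" "k \<noteq> i"
    using i xs(3) by (auto simp: j_def k_def mod_Suc)
  have edge: "{xs ! l, xs ! (Suc l mod n)} \<in> E" if "l < n" for l
    using that by (intro subsetD[OF xs(4)]) blast
  have E: "{v, xs ! k} \<in> E" "{xs ! j, v} \<in> E"
    using edge[OF i(1)] edge[OF jk(1)] jk(3) by (simp_all add: i(2) k_def)
  have ne: "{v, xs ! k} \<noteq> {xs ! j, v}"
    using jk i xs(1) len by (auto simp: doubleton_eq_iff nth_eq_iff_index_eq)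
  have "card {{v, xs ! k}, {xs ! j, v}} \<le> card {e \<in> E. v \<in> e}"
    using E assms(2) by (intro card_mono) auto
  then show "2 \<le> card {e \<in> E. v \<in> e}" using ne by simp
qed

text \<open>A vertex set is grown from \<open>{0}\<close> along edges leaving it, so
  \<open>k\<close> vertices span at least \<open>k - 1\<close> edges.\<close>

lemma connected_card:
  assumes con: "connectivity_game n E" and E: "E \<subseteq> complete_edges n"
  shows "n \<le> card E + 1"
proof (cases "n = 0")
  case False
  let ?R = "{(x, y). {x, y} \<in> E}"
  have finE: "finite E" using E finite_subset finite_complete_edges by blast
  have "k \<le> n \<Longrightarrow> \<exists>S\<subseteq>{..<n}. card S = k \<and> k \<le> card {e \<in> E. e \<subseteq> S} + 1" if "1 \<le> k" for k
    using that
  proof (induction k rule: dec_induct)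
    case base
    then show ?case using False by (intro exI[of _ "{0}"]) auto
  next
    case (step k)
    then obtain S where S: "S \<subseteq> {..<n}" "card S = k" "k \<le> card {e \<in> E. e \<subseteq> S} + 1"
      by auto
    have finS: "finite S" using S(1) finite_subset by blast
    obtain u where u: "u \<in> S" using S(2) step(1) by fastforce
    have "S \<noteq> {..<n}" using S(2) step by auto
    then obtain v where v: "v < n" "v \<notin> S" using S(1) by auto
    have uv: "(u, v) \<in> ?R\<^sup>*" using con u v S(1) unfolding connectivity_game_def by auto
    have "\<exists>x y. x \<in> S \<and> y \<notin> S \<and> {x, y} \<in> E"
    proof (rule ccontr)
      assume no: "\<not> ?thesis"
      from uv have "v \<in> S" by induction (use u no in auto)
      then show False using v by blast
    qed
    then obtain x y where xy: "x \<in> S" "y \<notin> S" "{x, y} \<in> E" by blast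
    have "insert {x, y} {e \<in> E. e \<subseteq> S} \<subseteq> {e \<in> E. e \<subseteq> insert y S}" using xy by auto
    then have "card (insert {x, y} {e \<in> E. e \<subseteq> S}) \<le> card {e \<in> E. e \<subseteq> insert y S}"
      using finE by (intro card_mono) auto
    then have "Suc k \<le> card {e \<in> E. e \<subseteq> insert y S} + 1" using S(3) xy finE by simp
    moreover have "y < n" using xy(3) E by (auto simp: complete_edges_def)
    ultimately show ?case using S finS xy by (intro exI[of _ "insert y S"]) auto
  qed
  from this[of n] obtain S where "n \<le> card {e \<in> E. e \<subseteq> S} + 1" using False by auto
  also have "card {e \<in> E. e \<subseteq> S} \<le> card E" using finE by (intro card_mono) auto
  finally show ?thesis by simp
qed simp

text \<open>Each edge is counted at its two ends, so the degrees sum to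
  \<open>2 * card E\<close>.\<close>

lemma min_degree_2_card:
  assumes deg: "min_degree_2_game n E" and E: "E \<subseteq> complete_edges n"
  shows "n \<le> card E"
proof -
  have finE: "finite E" using E finite_subset finite_complete_edges by blast
  have "2 * n = (\<Sum>v<n. 2)" by simp
  also have "\<dots> \<le> (\<Sum>v<n. card {e \<in> E. v \<in> e})"
    using deg by (intro sum_mono) (auto simp: min_degree_2_game_def)
  also have "\<dots> = 2 * card E"
  proof (rule sum_multicount)
    show "\<forall>e\<in>E. card {v \<in> {..<n}. v \<in> e} = 2"
    proof
      fix e assume "e \<in> E"
      then have "e \<subseteq> {..<n}" "card e = 2" using E by (auto simp: complete_edges_def)
      then show "card {v \<in> {..<n}. v \<in> e} = 2" by (simp add: Collect_conj_eq Int_absorb1 lessThan_def)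
    qed
  qed (use finE in auto)
  finally show ?thesis by simp
qed

section \<open>Bounding the number of Maker's edges\<close>

lemma breaker_turn_length_or_full:
  assumes "h' \<in> set_pmf (random_breaker_turn n b h)"
  shows "free_edges n h' = {} \<and> length h \<le> length h' \<or> length h' = length h + b"
  using assms
proof (induction b arbitrary: h)
  case (Suc b)
  then obtain h1 where h1: "h1 \<in> set_pmf (random_breaker_claim n h)"
    "h' \<in> set_pmf (random_breaker_turn n b h1)" by auto
  show ?case
  proof (cases "free_edges n h = {}")
    case True
    have "free_edges n h' = {}"
      using Suc.prems True by (rule breaker_turn_invariant) auto
    moreover have "length h \<le> length h'" using breaker_turn_append[OF Suc.prems] by auto
    ultimately show ?thesis by blast
  next
    case False
    then have "length h1 = Suc (length h)" using h1(1) by (auto simp: random_breaker_claim_def)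
    then show ?thesis using Suc.IH[OF h1(2)] by auto
  qed
qed auto

text \<open>Each Maker edge, except possibly the last, is followed by \<open>b\<close> Breaker
  edges.\<close>

lemma card_maker_edges_le:
  assumes h: "h \<in> set_pmf (continued_game n b \<sigma> t [])" and legal: "legal_strategy n \<sigma>"
  shows "card (claimed_by Maker h) * (b + 1) \<le> card (complete_edges n) + b"
proof -
  have len: "length h \<le> card (complete_edges n)" if "valid_history n h" for h
    using card_free_edges[OF that] by simp
  \<comment> \<open>The second bound, from which the next round starts, can be lost only in a round
    that exhausts the board; after that no edge is added.\<close>
  have "card (claimed_by Maker h) * (b + 1) \<le> length h + b \<and>
    (free_edges n h = {} \<or> card (claimed_by Maker h) * (b + 1) \<le> length h)"
    using h
  proof (induction t arbitrary: h)
    case (Suc t)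
    then obtain h1 where h1: "h1 \<in> set_pmf (continued_game n b \<sigma> t [])"
      "h \<in> set_pmf (random_breaker_turn n b (maker_turn n \<sigma> h1))" by auto
    note IH = Suc.IH[OF h1(1)]
    obtain g where g: "h = maker_turn n \<sigma> h1 @ g" "claimed_by Maker g = {}"
      using breaker_turn_append[OF h1(2)] by blast
    then have cM: "claimed_by Maker h = claimed_by Maker (maker_turn n \<sigma> h1)"
      by (simp add: claimed_by_append)
    show ?case
    proof (cases "free_edges n h1 = {}")
      case True
      then have mt: "maker_turn n \<sigma> h1 = h1" by (simp add: maker_turn_def)
      have "free_edges n h = {}"
        using h1(2) by (rule breaker_turn_invariant) (use True mt in auto)
      then show ?thesis using IH cM mt g(1) by auto
    next
      case False
      then have mt: "maker_turn n \<sigma> h1 = h1 @ [(Maker, \<sigma> h1)]" by (simp add: maker_turn_def)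
      have "card (claimed_by Maker h) \<le> Suc (card (claimed_by Maker h1))"
        using cM mt by (simp add: claimed_by_append card_insert_if)
      then have "card (claimed_by Maker h) * (b + 1) \<le> Suc (card (claimed_by Maker h1)) * (b + 1)"
        by (rule mult_right_mono) simp
      also have "\<dots> \<le> length (maker_turn n \<sigma> h1) + b" using IH False mt by simp
      finally show ?thesis using breaker_turn_length_or_full[OF h1(2)] by auto
    qed
  qed simp
  moreover have "length h \<le> card (complete_edges n)"
    using continued_game_valid[OF h _ legal] by (intro len) simp
  ultimately show ?thesis by linarith
qed

text \<open>Holds for every course of the game: Maker gets fewer than
  \<open>n / (1 + \<epsilon>) + 1\<close> edges, which for large \<open>n\<close> is at most
  \<open>n - 1\<close>, so the probability eventually equals 1.\<close>

lemma breaker_wins_above_threshold: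
  assumes \<epsilon>: "0 < \<epsilon>" and legal: "\<And>n. legal_strategy n (S n)"
    and W: "\<And>n E. W n E \<Longrightarrow> E \<subseteq> complete_edges n \<Longrightarrow> n \<le> card E + 1"
  shows "(\<lambda>n. measure_pmf.prob (full_half_random_game n (bias ((1 + \<epsilon>) * real (n div 2))) (S n))
               (breaker_wins W n)) \<longlonglongrightarrow> 1"
proof (rule tendsto_eventually)
  have "eventually (\<lambda>n. real n / (1 + \<epsilon>) + 1 \<le> real n - 1) sequentially"
  proof -
    define c where "c = 1 / (1 + \<epsilon>)"
    have c: "c < 1" using \<epsilon> by (simp add: c_def)
    have "eventually (\<lambda>n. 2 / (1 - c) \<le> real n) sequentially"
      using filterlim_real_sequentially by (simp add: filterlim_at_top)
    then show ?thesis
    proof eventually_elim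
      case (elim n)
      then have "2 \<le> real n * (1 - c)" using c by (simp add: divide_simps)
      then have "real n * c + 1 \<le> real n - 1" by (simp add: algebra_simps)
      then show ?case by (simp add: c_def)
    qed
  qed
  then show "\<forall>\<^sub>F n in sequentially. measure_pmf.prob
      (full_half_random_game n (bias ((1 + \<epsilon>) * real (n div 2))) (S n)) (breaker_wins W n) = 1"
    using eventually_ge_at_top[of 2]
  proof eventually_elim
    case (elim n)
    define b where "b = bias ((1 + \<epsilon>) * real (n div 2))"
    \<comment> \<open>Rounding costs little: \<open>n div 2 \<ge> (n - 1) / 2\<close>, and the 1
      lost in rounding the bias is made up by Maker's own edge in \<open>b + 1\<close>.\<close>
    have "n \<le> 2 * (n div 2) + 1" by simp
    then have "real n \<le> real (2 * (n div 2) + 1)" by (simp only: of_nat_le_iff)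
    then have "(1 + \<epsilon>) * ((real n - 1) / 2) \<le> (1 + \<epsilon>) * real (n div 2)"
      using \<epsilon> by (intro mult_left_mono) auto
    also have "\<dots> \<le> real b + 1" unfolding b_def bias_def by linarith
    finally have b1: "(1 + \<epsilon>) * ((real n - 1) / 2) \<le> real b + 1" .
    have "h \<in> breaker_wins W n" if h: "h \<in> set_pmf (full_half_random_game n b (S n))" for h
    proof (rule ccontr)
      assume "h \<notin> breaker_wins W n"
      then have "W n (claimed_by Maker h)" by (simp add: breaker_wins_def maker_wins_def)
      moreover have h': "h \<in> set_pmf (continued_game n b (S n) (card (complete_edges n)) [])"
        using h by (simp add: full_half_random_game_def half_random_game_eq)
      from continued_game_valid[OF h' _ legal] have "valid_history n h" by simp
      ultimately have "n \<le> card (claimed_by Maker h) + 1" using W claimed_subset by blast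
      then have "real n - 1 \<le> real (card (claimed_by Maker h))" by linarith
      then have "(real n - 1) * (real b + 1) \<le> real (card (claimed_by Maker h)) * (real b + 1)"
        by (intro mult_right_mono) auto
      also have "\<dots> = real (card (claimed_by Maker h) * (b + 1))"
        by (simp add: algebra_simps)
      also have "\<dots> \<le> real (card (complete_edges n) + b)"
        using card_maker_edges_le[OF h' legal] by (simp only: of_nat_le_iff)
      also have "\<dots> < real n * (real n - 1) / 2 + (real b + 1)"
        by (simp add: card_complete_edges)
      also have "real n * (real n - 1) / 2 = real n / (1 + \<epsilon>) * ((1 + \<epsilon>) * ((real n - 1) / 2))"
        using \<epsilon> by simp
      also have "\<dots> \<le> real n / (1 + \<epsilon>) * (real b + 1)"
        using \<epsilon> by (intro mult_left_mono b1) auto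
      also have "real n / (1 + \<epsilon>) * (real b + 1) + (real b + 1) = (real n / (1 + \<epsilon>) + 1) * (real b + 1)"
        by (simp add: algebra_simps)
      also have "\<dots> \<le> (real n - 1) * (real b + 1)"
        using elim(1) by (intro mult_right_mono) auto
      finally show False by simp
    qed
    then have "measure_pmf.prob (full_half_random_game n b (S n)) (breaker_wins W n) = 1"
      by (subst measure_pmf.prob_eq_1) (auto simp: AE_measure_pmf_iff)
    then show ?case by (simp add: b_def)
  qed
qed

section \<open>The strategy\<close>

text \<open>Unspecified if there is no such \<open>Q\<close>; positions where this can happen are
  charged to the failure of expansion.\<close>

definition completion :: "nat \<Rightarrow> nat \<Rightarrow> history \<Rightarrow> edge set" where
  "completion n L h = (SOME Q. Q \<subseteq> complete_edges n \<and> card Q \<le> 12 * L + 1 \<and>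
     Q \<inter> claimed_by Breaker h = {} \<and> hamiltonicity_game n (claimed_by Maker h \<union> Q))"

text \<open>A round lasts \<open>b + 1\<close> claims, so the length of the history tells the round, and the history
  after \<open>n\<close> rounds, which fixes the edges to be claimed in the second phase, is a prefix of the
  current one.\<close>

definition targets :: "nat \<Rightarrow> nat \<Rightarrow> nat \<Rightarrow> history \<Rightarrow> edge set" where
  "targets n b L h = (if length h < n * (b + 1)
     then {e. dfs_state n L (claimed_by Breaker h) (insert e (claimed_by Maker h)) (Suc (length h div (b + 1)))}
     else completion n L (take (n * (b + 1)) h))"

text \<open>The implication keeps the choice legal when no target is free.\<close>

definition hamilton_strategy :: "nat \<Rightarrow> nat \<Rightarrow> nat \<Rightarrow> strategy" where
  "hamilton_strategy n b L h = (SOME e. e \<in> free_edges n h \<and>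
     (targets n b L h \<inter> free_edges n h \<noteq> {} \<longrightarrow> e \<in> targets n b L h))"

lemma hamilton_strategy:
  assumes "free_edges n h \<noteq> {}"
  shows "hamilton_strategy n b L h \<in> free_edges n h"
    and "targets n b L h \<inter> free_edges n h \<noteq> {} \<Longrightarrow> hamilton_strategy n b L h \<in> targets n b L h"
proof -
  have "\<exists>e. e \<in> free_edges n h \<and> (targets n b L h \<inter> free_edges n h \<noteq> {} \<longrightarrow> e \<in> targets n b L h)"
    using assms by blast
  from someI_ex[OF this]
  show "hamilton_strategy n b L h \<in> free_edges n h"
    and "targets n b L h \<inter> free_edges n h \<noteq> {} \<Longrightarrow> hamilton_strategy n b L h \<in> targets n b L h"
    unfolding hamilton_strategy_def by blast+
qed

lemma legal_hamilton_strategy: "legal_strategy n (hamilton_strategy n b L)"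
  by (simp add: legal_strategy_def hamilton_strategy)

lemma completion:
  assumes L: "0 < L" "6 * L + 2 \<le> n div L"
    and val: "valid_history n h" and ex: "expanding n L (claimed_by Breaker h)"
    and st: "dfs_state n L (claimed_by Breaker h) (claimed_by Maker h) n"
  shows "completion n L h \<subseteq> complete_edges n" "card (completion n L h) \<le> 12 * L + 1"
    "completion n L h \<inter> claimed_by Breaker h = {}"
    "hamiltonicity_game n (claimed_by Maker h \<union> completion n L h)"
proof -
  obtain xs where xs: "distinct xs" "set xs \<subseteq> {..<n}" "path_edges xs \<subseteq> claimed_by Maker h"
    "n \<le> length xs + 2 * L"
    using dfs_state_final[OF ex st] .
  obtain Q where Q: "finite Q" "card Q \<le> 12 * L + 1" "Q \<inter> claimed_by Breaker h = {}"
    "hamiltonicity_game n (claimed_by Maker h \<union> Q)"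
    using hamilton_completion[OF ex L xs(1,2,4,3) claimed_disjoint[OF val]] by blast
  then obtain C where C: "C \<subseteq> claimed_by Maker h \<union> Q" "hamilton_cycle n C"
    unfolding hamiltonicity_game_def by auto
  \<comment> \<open>\<open>Q\<close> is not known to lie on the board, but the cycle does, so
    \<open>Q\<close> can be cut down to it.\<close>
  then have "C \<subseteq> claimed_by Maker h \<union> (Q \<inter> complete_edges n)"
    using hamilton_cycle_subset_complete_edges[OF C(2)] by auto
  with C(2) have "hamiltonicity_game n (claimed_by Maker h \<union> (Q \<inter> complete_edges n))"
    unfolding hamiltonicity_game_def by (intro exI[of _ C] conjI)
  moreover have "card (Q \<inter> complete_edges n) \<le> 12 * L + 1"
    using Q(1,2) card_mono[of Q "Q \<inter> complete_edges n"] by simp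
  ultimately have "\<exists>Q. Q \<subseteq> complete_edges n \<and> card Q \<le> 12 * L + 1 \<and>
     Q \<inter> claimed_by Breaker h = {} \<and> hamiltonicity_game n (claimed_by Maker h \<union> Q)"
    using Q(3) by (intro exI[of _ "Q \<inter> complete_edges n"]) auto
  from someI_ex[OF this]
  show "completion n L h \<subseteq> complete_edges n" "card (completion n L h) \<le> 12 * L + 1"
    "completion n L h \<inter> claimed_by Breaker h = {}"
    "hamiltonicity_game n (claimed_by Maker h \<union> completion n L h)"
    unfolding completion_def by blast+
qed

text \<open>The strategy stores no search state: it claims any edge after which some state exists,
  and \<open>dfs_state_step\<close> provides one.\<close>

lemma dfs_phase:
  assumes L: "0 < L" "6 * L + 2 \<le> n div L" and board: "n * (b + 1) \<le> card (complete_edges n)"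
    and h: "h \<in> set_pmf (half_random_game n b (hamilton_strategy n b L) t)" "t \<le> n"
    and ex: "expanding n L (claimed_by Breaker h)"
  shows "dfs_state n L (claimed_by Breaker h) (claimed_by Maker h) t"
  using h ex
proof (induction t arbitrary: h)
  case 0
  have "n div L \<le> n" by simp
  then have "L < n" using L by linarith
  then show ?case using 0 dfs_state_init by simp
next
  case (Suc t)
  let ?\<sigma> = "hamilton_strategy n b L"
  obtain h1 where h1: "h1 \<in> set_pmf (half_random_game n b ?\<sigma> t)"
    "h \<in> set_pmf (random_breaker_turn n b (maker_turn n ?\<sigma> h1))" using Suc.prems(1) by auto
  have h1': "h1 \<in> set_pmf (continued_game n b ?\<sigma> t [])" using h1(1) by (simp add: half_random_game_eq)
  have tn: "Suc t * (b + 1) \<le> n * (b + 1)" using Suc.prems(2) by (intro mult_right_mono) auto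
  have val: "valid_history n h1"
    using continued_game_valid[OF h1' _ legal_hamilton_strategy] by simp
  have len: "length h1 = t * (b + 1)"
    using continued_game_length[OF h1' _ legal_hamilton_strategy] tn board by simp
  have free: "free_edges n h1 \<noteq> {}"
    using val len tn board by (intro free_edges_nonempty) auto
  then have mt: "maker_turn n ?\<sigma> h1 = h1 @ [(Maker, ?\<sigma> h1)]" by (simp add: maker_turn_def)
  obtain g where g: "h = maker_turn n ?\<sigma> h1 @ g" using breaker_turn_append[OF h1(2)] by blast
  have sub: "claimed_by Breaker h1 \<subseteq> claimed_by Breaker h"
    "insert (?\<sigma> h1) (claimed_by Maker h1) \<subseteq> claimed_by Maker h"
    by (auto simp: g mt claimed_by_append)
  have ex1: "expanding n L (claimed_by Breaker h1)"
    using expanding_antimono[OF Suc.prems(3) sub(1)] .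
  have "dfs_state n L (claimed_by Breaker h1) (claimed_by Maker h1) t"
    using Suc.IH[OF h1(1) _ ex1] Suc.prems(2) by simp
  then have "\<exists>e\<in>free_edges n h1.
      dfs_state n L (claimed_by Breaker h1) (insert e (claimed_by Maker h1)) (Suc t)"
    using L free by (intro dfs_state_step[OF ex1]) (auto simp: free_edges_def)
  moreover have tg: "targets n b L h1 =
      {e. dfs_state n L (claimed_by Breaker h1) (insert e (claimed_by Maker h1)) (Suc t)}"
  proof -
    have "length h1 < n * (b + 1)" using len tn by simp
    moreover have "length h1 div (b + 1) = t" unfolding len by (rule nonzero_mult_div_cancel_right) simp
    ultimately show ?thesis unfolding targets_def by simp
  qed
  ultimately have "?\<sigma> h1 \<in> targets n b L h1"
    using free by (intro hamilton_strategy(2)) auto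
  then have "dfs_state n L (claimed_by Breaker h1) (insert (?\<sigma> h1) (claimed_by Maker h1)) (Suc t)"
    unfolding tg by blast
  then show ?case using sub by (rule dfs_state_mono)
qed

text \<open>As long as Breaker hits no edge of \<open>Q\<close>, every edge of \<open>Q\<close> that
  Maker lacks is a free target, so each round claims one more until none is left.\<close>

lemma completion_phase:
  assumes h0: "valid_history n h0" "length h0 = n * (b + 1)"
    and board: "(n + r) * (b + 1) \<le> card (complete_edges n)"
    and Q: "Q = completion n L h0" "Q \<subseteq> complete_edges n"
    and h: "h \<in> set_pmf (continued_game n b (hamilton_strategy n b L) r h0)"
      "Q \<inter> claimed_by Breaker h = {}"
  shows "card (Q - claimed_by Maker h) \<le> card Q - r"
  using h board
proof (induction r arbitrary: h)
  case 0
  then show ?case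
    using finite_subset[OF Q(2)] by (simp add: card_mono Diff_subset)
next
  case (Suc r)
  let ?\<sigma> = "hamilton_strategy n b L"
  have finQ: "finite Q" using Q(2) finite_subset finite_complete_edges by blast
  obtain h1 where h1: "h1 \<in> set_pmf (continued_game n b ?\<sigma> r h0)"
    "h \<in> set_pmf (random_breaker_turn n b (maker_turn n ?\<sigma> h1))" using Suc.prems(1) by auto
  have bd: "n * (b + 1) + r * (b + 1) < card (complete_edges n)"
    using Suc.prems(3) by (simp add: algebra_simps)
  have val: "valid_history n h1"
    using continued_game_valid[OF h1(1) h0(1) legal_hamilton_strategy] .
  have len: "length h1 = n * (b + 1) + r * (b + 1)"
    using continued_game_length[OF h1(1) h0(1) legal_hamilton_strategy] h0(2) bd by simp
  have free: "free_edges n h1 \<noteq> {}"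
    using val len bd by (intro free_edges_nonempty) auto
  then have mt: "maker_turn n ?\<sigma> h1 = h1 @ [(Maker, ?\<sigma> h1)]" by (simp add: maker_turn_def)
  obtain g where g: "h = maker_turn n ?\<sigma> h1 @ g" using breaker_turn_append[OF h1(2)] by blast
  have sub: "claimed_by Breaker h1 \<subseteq> claimed_by Breaker h"
    "insert (?\<sigma> h1) (claimed_by Maker h1) \<subseteq> claimed_by Maker h"
    by (auto simp: g mt claimed_by_append)
  have Q1: "Q \<inter> claimed_by Breaker h1 = {}" using sub(1) Suc.prems(2) by blast
  have IH: "card (Q - claimed_by Maker h1) \<le> card Q - r"
    using Suc.IH[OF h1(1) Q1] bd by (simp add: algebra_simps)
  obtain g1 where g1: "h1 = h0 @ g1"
    using continued_game_append[OF h1(1) legal_hamilton_strategy] by blast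
  have tg: "targets n b L h1 = Q"
    using len h0(2) by (simp add: targets_def Q(1) g1)
  show ?case
  proof (cases "Q - claimed_by Maker h1 = {}")
    case True
    then have "Q - claimed_by Maker h = {}" using sub(2) by blast
    then show ?thesis by (simp only: card.empty)
  next
    case False
    then have "targets n b L h1 \<inter> free_edges n h1 \<noteq> {}"
      using Q1 Q(2) by (auto simp: tg free_edges_def)
    then have "?\<sigma> h1 \<in> Q" "?\<sigma> h1 \<in> free_edges n h1"
      using hamilton_strategy[OF free, of b L] tg by auto
    then have in_Q: "?\<sigma> h1 \<in> Q - claimed_by Maker h1" by (simp add: free_edges_def)
    have "card (Q - claimed_by Maker h) \<le> card (Q - claimed_by Maker h1 - {?\<sigma> h1})"
      using finQ sub(2) by (intro card_mono) auto
    also have "\<dots> = card (Q - claimed_by Maker h1) - 1"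
      using in_Q by simp
    finally show ?thesis using IH by simp
  qed
qed

text \<open>Conditions on the position after \<open>n\<close> rounds. If it is expanding,
  \<open>12 * L + 1\<close> rounds suffice to claim the completion unless Breaker hits it; otherwise
  the loss is bounded by 1.\<close>

lemma prob_maker_loses_le:
  assumes L: "0 < L" "6 * L + 2 \<le> n div L"
    and s: "0 < s" "real ((n + (12 * L + 1)) * (b + 1)) + s \<le> real (card (complete_edges n))"
    and \<sigma>: "\<sigma> = hamilton_strategy n b L"
  shows "measure_pmf.prob (half_random_game n b \<sigma> (n + (12 * L + 1))) (- maker_wins hamiltonicity_game n)
    \<le> measure_pmf.prob (half_random_game n b \<sigma> n) {h. \<not> expanding n L (claimed_by Breaker h)}
      + real (12 * L + 1) * real ((12 * L + 1) * (b + 1)) / s"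
proof -
  define m where "m = 12 * L + 1"
  define c where "c = real m * real (m * (b + 1)) / s"
  define bad where "bad = {h. \<not> expanding n L (claimed_by Breaker h)}"
  define p where "p = half_random_game n b \<sigma> n"
  have c0: "0 \<le> c" using s(1) by (simp add: c_def)
  have legal: "legal_strategy n \<sigma>" by (simp add: \<sigma> legal_hamilton_strategy)
  have "real ((n + m) * (b + 1)) \<le> real (card (complete_edges n))" using s unfolding m_def by linarith
  then have board: "(n + m) * (b + 1) \<le> card (complete_edges n)" by (simp only: of_nat_le_iff)
  then have board0: "n * (b + 1) \<le> card (complete_edges n)" by (simp add: algebra_simps)
  have step: "measure_pmf.prob (continued_game n b \<sigma> m h0) (- maker_wins hamiltonicity_game n)
      \<le> indicator bad h0 + c" if h0: "h0 \<in> set_pmf p" for h0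
  proof (cases "h0 \<in> bad")
    case True
    then show ?thesis using c0 measure_pmf.prob_le_1[of "continued_game n b \<sigma> m h0"]
      by (simp add: add_increasing2)
  next
    case False
    then have ex: "expanding n L (claimed_by Breaker h0)" by (simp add: bad_def)
    have h0': "h0 \<in> set_pmf (continued_game n b \<sigma> n [])" using h0 by (simp add: p_def half_random_game_eq)
    have val: "valid_history n h0" using continued_game_valid[OF h0' _ legal] by simp
    have len: "length h0 = n * (b + 1)" using continued_game_length[OF h0' _ legal] board0 by simp
    have st: "dfs_state n L (claimed_by Breaker h0) (claimed_by Maker h0) n"
      using dfs_phase[OF L board0 _ _ ex, of n] h0 by (simp add: p_def \<sigma>)
    define Q where "Q = completion n L h0"
    note Q = completion[OF L val ex st, folded Q_def]
    have finQ: "finite Q" using Q(1) finite_subset finite_complete_edges by blast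
    have "measure_pmf.prob (continued_game n b \<sigma> m h0) (- maker_wins hamiltonicity_game n)
      \<le> measure_pmf.prob (continued_game n b \<sigma> m h0) {h. Q \<inter> claimed_by Breaker h \<noteq> {}}"
    proof (rule measure_pmf.finite_measure_mono_AE[OF AE_pmfI])
      fix h assume h: "h \<in> set_pmf (continued_game n b \<sigma> m h0)"
      show "h \<in> - maker_wins hamiltonicity_game n \<longrightarrow> h \<in> {h. Q \<inter> claimed_by Breaker h \<noteq> {}}"
      proof (rule impI, rule ccontr)
        assume lose: "h \<in> - maker_wins hamiltonicity_game n"
          and "h \<notin> {h. Q \<inter> claimed_by Breaker h \<noteq> {}}"
        then have "Q \<inter> claimed_by Breaker h = {}" by simp
        then have "card (Q - claimed_by Maker h) \<le> card Q - m"
          using completion_phase[OF val len board Q_def Q(1)] h by (simp add: \<sigma>)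
        then have "card (Q - claimed_by Maker h) = 0" using Q(2) by (simp add: m_def)
        then have "Q \<subseteq> claimed_by Maker h" using finQ by simp
        moreover have "claimed_by Maker h0 \<subseteq> claimed_by Maker h"
          using continued_game_append[OF h legal] by (auto simp: claimed_by_append)
        ultimately have "hamiltonicity_game n (claimed_by Maker h)"
          using Q(4) unfolding hamiltonicity_game_def by blast
        then show False using lose by (simp add: maker_wins_def)
      qed
    qed simp
    also have "\<dots> \<le> real (card Q) * real (m * (b + 1)) / s"
    proof (rule prob_breaker_hits_le[OF legal finQ Q(3) val s(1)])
      have "length h0 + m * (b + 1) = (n + m) * (b + 1)" by (simp add: len algebra_simps)
      then show "real (length h0 + m * (b + 1)) + s \<le> real (card (complete_edges n))"
        using s(2) unfolding m_def by (simp only:)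
    qed
    also have "\<dots> \<le> c"
      unfolding c_def using Q(2) s(1) by (intro divide_right_mono mult_right_mono) (auto simp: m_def)
    finally show ?thesis using False by simp
  qed
  have "ennreal (measure_pmf.prob (half_random_game n b \<sigma> (n + m)) (- maker_wins hamiltonicity_game n))
    = (\<integral>\<^sup>+h0. ennreal (measure_pmf.prob (continued_game n b \<sigma> m h0) (- maker_wins hamiltonicity_game n)) \<partial>measure_pmf p)"
    by (simp add: half_random_game_add p_def measure_pmf.emeasure_eq_measure[symmetric])
  also have "\<dots> \<le> (\<integral>\<^sup>+h0. indicator bad h0 + ennreal c \<partial>measure_pmf p)"
  proof (intro nn_integral_mono_AE AE_pmfI)
    fix h0 assume "h0 \<in> set_pmf p"
    from ennreal_leI[OF step[OF this]]
    show "ennreal (measure_pmf.prob (continued_game n b \<sigma> m h0) (- maker_wins hamiltonicity_game n))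
      \<le> indicator bad h0 + ennreal c"
      using c0 by (simp add: ennreal_plus ennreal_indicator)
  qed
  also have "\<dots> = ennreal (measure_pmf.prob p bad + c)"
    using c0 by (simp add: nn_integral_add measure_pmf.emeasure_eq_measure)
  finally have "measure_pmf.prob (half_random_game n b \<sigma> (n + m)) (- maker_wins hamiltonicity_game n)
      \<le> measure_pmf.prob p bad + c"
    using c0 by (subst (asm) ennreal_le_iff) auto
  then show ?thesis unfolding m_def c_def bad_def p_def .
qed

section \<open>The union bound for expansion\<close>

lemma prob_breaker_claims_all_pairs_le:
  assumes legal: "legal_strategy n \<sigma>"
    and AB: "A \<subseteq> {..<n}" "B \<subseteq> {..<n}" "A \<inter> B = {}"
    and s: "0 < s" "real (t * (b + 1)) + s \<le> real (card (complete_edges n))"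
  shows "measure_pmf.prob (half_random_game n b \<sigma> t) {h. \<forall>u\<in>A. \<forall>v\<in>B. {u, v} \<in> claimed_by Breaker h}
    \<le> (1 - s / real (card (complete_edges n))) ^ (card A * card B)"
proof -
  define Q where "Q = (\<lambda>(u, v). {u, v}) ` (A \<times> B)"
  have "inj_on (\<lambda>(u, v). {u, v}) (A \<times> B)"
    using AB(3) by (auto simp: inj_on_def doubleton_eq_iff)
  then have card: "card Q = card A * card B"
    by (simp add: Q_def card_image card_cartesian_product)
  have Q: "Q \<subseteq> complete_edges n"
    using AB by (auto simp: Q_def intro!: pair_in_complete_edges)
  have "{h. \<forall>u\<in>A. \<forall>v\<in>B. {u, v} \<in> claimed_by Breaker h} = {h. Q \<subseteq> claimed_by Breaker h}"
    by (auto simp: Q_def)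
  then show ?thesis
    using prob_breaker_claims_all_le[OF legal Q s] card by simp
qed

text \<open>There are at most \<open>n ^ L\<close> choices for each of \<open>A\<close> and
  \<open>B\<close>, with \<open>L * L\<close> edges between them, and at most \<open>n ^ 2\<close>
  pairs of a vertex and a block, with \<open>L\<close> edges. Both terms are small once
  \<open>n ^ 2 * x ^ L\<close> is.\<close>

lemma prob_not_expanding_le:
  assumes legal: "legal_strategy n \<sigma>" and L: "0 < L"
    and s: "0 < s" "real (t * (b + 1)) + s \<le> real (card (complete_edges n))"
    and x: "x = 1 - s / real (card (complete_edges n))"
  shows "measure_pmf.prob (half_random_game n b \<sigma> t) {h. \<not> expanding n L (claimed_by Breaker h)}
    \<le> (real n ^ 2 * x ^ L) ^ L + real n ^ 2 * x ^ L"
proof -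
  let ?p = "measure_pmf.prob (half_random_game n b \<sigma> t)"
  define hit where "hit A B = {h. \<forall>u\<in>A. \<forall>v\<in>B. {u, v} \<in> claimed_by Breaker h}" for A B :: "nat set"
  define S where "S = {A. A \<subseteq> {..<n} \<and> card A = L}"
  define I where "I = {(A, B). A \<in> S \<and> B \<in> S \<and> A \<inter> B = {}}"
  define J where "J = {(v, k). v < n \<and> k < n div L \<and> k \<noteq> v div L}"
  have "s \<le> real (card (complete_edges n))" using s(2) by (rule order_trans[rotated]) simp
  then have x0: "0 \<le> x" using s(1) by (simp add: x divide_simps)
  have finS: "finite S" unfolding S_def by (rule finite_subset[of _ "Pow {..<n}"]) auto
  have finI: "finite I" unfolding I_def by (rule finite_subset[of _ "S \<times> S"]) (use finS in auto)
  have finJ: "finite J" unfolding J_def by (rule finite_subset[of _ "{..<n} \<times> {..<n div L}"]) auto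
  have "card S = n choose L" using n_subsets[of "{..<n}" L] by (simp add: S_def)
  also have "\<dots> \<le> n ^ L"
  proof (cases "L \<le> n")
    case True
    then show ?thesis by (rule binomial_le_pow)
  qed (simp add: binomial_eq_0)
  finally have cS: "card S \<le> n ^ L" .
  have "card I \<le> card (S \<times> S)" using finS by (intro card_mono) (auto simp: I_def)
  also have "\<dots> \<le> n ^ L * n ^ L" using cS by (simp add: card_cartesian_product mult_le_mono)
  finally have "real (card I) \<le> real (n ^ L * n ^ L)" by (simp only: of_nat_le_iff)
  then have cI: "real (card I) \<le> (real n ^ 2) ^ L" by (simp add: power_mult_distrib power2_eq_square)
  have "card J \<le> card ({..<n} \<times> {..<n div L})" by (intro card_mono) (auto simp: J_def)
  also have "\<dots> \<le> n * n" by (simp add: card_cartesian_product)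
  finally have "real (card J) \<le> real (n * n)" by (simp only: of_nat_le_iff)
  then have cJ: "real (card J) \<le> real n ^ 2" by (simp add: power2_eq_square)
  have block: "{k * L..<k * L + L} \<subseteq> {..<n}" "v \<notin> {k * L..<k * L + L}" if "(v, k) \<in> J" for v k
  proof -
    have "Suc k * L \<le> (n div L) * L" using that by (intro mult_right_mono) (auto simp: J_def)
    also have "\<dots> \<le> n" by simp
    finally show "{k * L..<k * L + L} \<subseteq> {..<n}" by auto
    show "v \<notin> {k * L..<k * L + L}"
    proof
      assume "v \<in> {k * L..<k * L + L}"
      then have "v div L = k" by (intro div_nat_eqI) (auto simp: mult.commute)
      then show False using that by (simp add: J_def)
    qed
  qed
  have pI: "?p (case i of (A, B) \<Rightarrow> hit A B) \<le> x ^ (L * L)" if i: "i \<in> I" for i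
  proof -
    obtain A B where "i = (A, B)" "A \<subseteq> {..<n}" "B \<subseteq> {..<n}" "A \<inter> B = {}" "card A = L" "card B = L"
      using i by (cases i) (auto simp: I_def S_def)
    then show ?thesis
      using prob_breaker_claims_all_pairs_le[OF legal _ _ _ s, of A B] by (simp add: hit_def x)
  qed
  have pJ: "?p (case j of (v, k) \<Rightarrow> hit {v} {k * L..<k * L + L}) \<le> x ^ L" if "j \<in> J" for j
  proof -
    obtain v k where j: "j = (v, k)" by (cases j)
    have "v < n" using that by (simp add: j J_def)
    then show ?thesis
      using prob_breaker_claims_all_pairs_le[OF legal _ _ _ s, of "{v}" "{k * L..<k * L + L}"]
        block[of v k] that by (simp add: hit_def x j)
  qed
  have "{h. \<not> expanding n L (claimed_by Breaker h)} \<subseteq>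
      (\<Union>i\<in>I. case i of (A, B) \<Rightarrow> hit A B) \<union> (\<Union>j\<in>J. case j of (v, k) \<Rightarrow> hit {v} {k * L..<k * L + L})"
    (is "_ \<subseteq> ?U \<union> ?V")
  proof
    fix h assume "h \<in> {h. \<not> expanding n L (claimed_by Breaker h)}"
    then consider A B where "A \<in> S" "B \<in> S" "A \<inter> B = {}" "h \<in> hit A B"
      | v k where "v < n" "k < n div L" "k \<noteq> v div L" "h \<in> hit {v} {k * L..<k * L + L}"
      unfolding expanding_def S_def hit_def by auto
    then show "h \<in> ?U \<union> ?V"
    proof cases
      case 1
      then have "(A, B) \<in> I" by (simp add: I_def)
      with 1 show ?thesis by blast
    next
      case 2
      then have "(v, k) \<in> J" by (simp add: J_def)
      with 2 show ?thesis by blast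
    qed
  qed
  then have "?p {h. \<not> expanding n L (claimed_by Breaker h)} \<le> ?p (?U \<union> ?V)"
    by (intro measure_pmf.finite_measure_mono) auto
  also have "\<dots> \<le> ?p ?U + ?p ?V" by (intro measure_Un_le) auto
  also have "?p ?U \<le> (\<Sum>i\<in>I. ?p (case i of (A, B) \<Rightarrow> hit A B))"
    using finI by (intro measure_UNION_le) auto
  also have "\<dots> \<le> real (card I) * x ^ (L * L)" using pI by (rule sum_bounded_above)
  also have "\<dots> \<le> (real n ^ 2) ^ L * x ^ (L * L)" using cI x0 by (intro mult_right_mono) auto
  also have "\<dots> = (real n ^ 2 * x ^ L) ^ L" by (simp add: power_mult_distrib power_mult)
  also have "?p ?V \<le> (\<Sum>j\<in>J. ?p (case j of (v, k) \<Rightarrow> hit {v} {k * L..<k * L + L}))"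
    using finJ by (intro measure_UNION_le) auto
  also have "\<dots> \<le> real (card J) * x ^ L" using pJ by (rule sum_bounded_above)
  also have "\<dots> \<le> real n ^ 2 * x ^ L" using cJ x0 by (intro mult_right_mono) auto
  finally show ?thesis by simp
qed

section \<open>Asymptotics\<close>

text \<open>Brings \<epsilon> below 1, as the asymptotics require; for \<epsilon> \<ge> 1 the bias
  is 0. The separate \<open>y\<close> covers both \<open>n / 2\<close> and
  \<open>n div 2\<close>.\<close>

lemma bias_le: "0 \<le> x \<Longrightarrow> x \<le> y \<Longrightarrow> real (bias ((1 - \<epsilon>) * x)) \<le> (1 - min \<epsilon> (1 / 2)) * y"
proof -
  assume x: "0 \<le> x" "x \<le> y"
  have "real (bias ((1 - \<epsilon>) * x)) \<le> max 0 ((1 - \<epsilon>) * x)"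
    unfolding bias_def by linarith
  also have "\<dots> \<le> (1 - min \<epsilon> (1 / 2)) * x"
    using x by (auto intro!: mult_right_mono)
  also have "\<dots> \<le> (1 - min \<epsilon> (1 / 2)) * y"
    using x by (intro mult_left_mono) auto
  finally show ?thesis .
qed

text \<open>With a fraction \<open>\<epsilon> / 2\<close> of the board left free,
  \<open>x \<le> exp (- (\<epsilon> / 2))\<close>; the factor \<open>6 / \<epsilon>\<close> then
  gives \<open>x ^ L \<le> 1 / n ^ 3\<close>, which beats the \<open>n ^ 2\<close> of the union
  bound.\<close>

definition depth :: "real \<Rightarrow> nat \<Rightarrow> nat" where
  "depth \<epsilon> n = nat \<lceil>6 / \<epsilon> * ln (real n)\<rceil>"

lemma depth_bounds:
  assumes "0 < \<epsilon>" "1 \<le> n"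
  shows "6 / \<epsilon> * ln (real n) \<le> real (depth \<epsilon> n)" "real (depth \<epsilon> n) \<le> 6 / \<epsilon> * ln (real n) + 1"
proof -
  have "0 \<le> 6 / \<epsilon> * ln (real n)" using assms by (intro mult_nonneg_nonneg) auto
  then show "6 / \<epsilon> * ln (real n) \<le> real (depth \<epsilon> n)" "real (depth \<epsilon> n) \<le> 6 / \<epsilon> * ln (real n) + 1"
    unfolding depth_def by linarith+
qed

text \<open>The second conclusion, that the rounds fit into the full game, is what transfers the
  first one to it.\<close>

lemma hamilton_strategy_wins:
  fixes b :: "nat \<Rightarrow> nat"
  assumes \<epsilon>: "0 < \<epsilon>" "\<epsilon> < 1" and b: "\<And>n. real (b n) \<le> (1 - \<epsilon>) * (real n / 2)"
  defines "L \<equiv> depth \<epsilon>"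
  shows "(\<lambda>n. measure_pmf.prob
      (half_random_game n (b n) (hamilton_strategy n (b n) (L n)) (n + (12 * L n + 1)))
      (maker_wins hamiltonicity_game n)) \<longlonglongrightarrow> 1"
    and "eventually (\<lambda>n. n + (12 * L n + 1) \<le> card (complete_edges n)) sequentially"
proof -
  define c where "c = 6 / \<epsilon>"
  have c: "0 < c" using \<epsilon> by (simp add: c_def)
  define u where "u n = c * ln (real n) + 1" for n :: nat
  define K where "K n = real n * (real n - 1) / 2" for n :: nat
  \<comment> \<open>Failure of expansion contributes \<open>2 / n\<close>; a hit in the second phase
    contributes the number of targets times the number of claims over \<open>s\<close>, of order
    \<open>(ln n) ^ 2 / n\<close>.\<close>
  define r where "r n = 2 / real n + (12 * u n + 1) ^ 2 * ((1 - \<epsilon>) * (real n / 2) + 1) / (\<epsilon> / 2 * K n)" for n :: nat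
  have ev1: "eventually (\<lambda>n. (real n + (12 * u n + 1)) * ((1 - \<epsilon>) * (real n / 2) + 1) + \<epsilon> / 2 * K n \<le> K n) sequentially"
  proof -
    \<comment> \<open>The leading terms \<open>(1 - \<epsilon>) * n ^ 2 / 2\<close> and
      \<open>(1 - \<epsilon> / 2) * n ^ 2 / 2\<close> differ by
      \<open>\<epsilon> / 4 * n ^ 2\<close>, which has to absorb a rest of order
      \<open>n * ln n\<close>.\<close>
    have "eventually (\<lambda>n. 3 / 2 * real n + (12 * u n + 1) * real n + (12 * u n + 1) \<le> \<epsilon> / 4 * real n ^ 2) sequentially"
      unfolding u_def using \<epsilon> c by real_asymp
    moreover have "eventually (\<lambda>n. 0 \<le> 12 * u n + 1) sequentially"
      unfolding u_def using c by real_asymp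
    ultimately show ?thesis
    proof eventually_elim
      case (elim n)
      define w where "w = 12 * u n + 1"
      have "w * real n * ((1 - \<epsilon>) / 2) \<le> w * real n * 1"
        using elim(2) \<epsilon> by (intro mult_left_mono) (auto simp: w_def)
      moreover have "0 \<le> \<epsilon> * real n" using \<epsilon> by simp
      ultimately show ?case
        using elim(1) unfolding w_def[symmetric] K_def
        by (simp add: field_simps power2_eq_square)
    qed
  qed
  \<comment> \<open>As \<open>u n\<close> bounds \<open>L n\<close> from above, this yields
    \<open>6 * L n + 2 \<le> n div L n\<close>.\<close>
  have ev2: "eventually (\<lambda>n. (6 * u n + 2) * u n \<le> real n) sequentially"
    unfolding u_def using c by real_asymp
  have ev3: "eventually (\<lambda>n. 1 < c * ln (real n)) sequentially"
    using c by real_asymp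
  have r0: "r \<longlonglongrightarrow> 0"
    unfolding r_def u_def K_def using \<epsilon> c by real_asymp
  have main: "eventually (\<lambda>n. n + (12 * L n + 1) \<le> card (complete_edges n) \<and>
    measure_pmf.prob
      (half_random_game n (b n) (hamilton_strategy n (b n) (L n)) (n + (12 * L n + 1)))
      (- maker_wins hamiltonicity_game n) \<le> r n) sequentially"
    using ev1 ev2 ev3 eventually_ge_at_top[of 2]
  proof eventually_elim
    case (elim n)
    define N where "N = real (card (complete_edges n))"
    define s where "s = \<epsilon> / 2 * N"
    define m where "m = 12 * L n + 1"
    have n1: "1 \<le> n" using elim(4) by simp
    note Lb = depth_bounds[OF \<epsilon>(1) n1, folded L_def c_def]
    have Lu: "real (L n) \<le> u n" using Lb by (simp add: u_def)
    have NK: "N = K n" by (simp add: N_def K_def card_complete_edges)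
    have N0: "0 < N" using elim(4) by (simp add: NK K_def)
    then have s0: "0 < s" using \<epsilon> by (simp add: s_def)
    have "1 < real (L n)" using Lb(1) elim(3) by linarith
    then have L0: "0 < L n" by simp
    have b1: "real (b n + 1) \<le> (1 - \<epsilon>) * (real n / 2) + 1" using b[of n] by simp
    have mu: "real m \<le> 12 * u n + 1" using Lu by (simp add: m_def)
    have "real ((n + m) * (b n + 1)) = real (n + m) * real (b n + 1)" by (rule of_nat_mult)
    also have "\<dots> \<le> (real n + (12 * u n + 1)) * ((1 - \<epsilon>) * (real n / 2) + 1)"
      using mu b1 by (intro mult_mono) auto
    finally have board: "real ((n + m) * (b n + 1)) + s \<le> N"
      using elim(1) by (simp add: s_def NK)
    have "real ((6 * L n + 2) * L n) = (6 * real (L n) + 2) * real (L n)"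
      by (simp add: algebra_simps)
    also have "\<dots> \<le> (6 * u n + 2) * u n"
      using Lu by (intro mult_mono) auto
    also have "\<dots> \<le> real n" by (rule elim(2))
    finally have "(6 * L n + 2) * L n \<le> n" by (simp only: of_nat_le_iff)
    then have Ln: "6 * L n + 2 \<le> n div L n" using L0 by (simp only: less_eq_div_iff_mult_less_eq)
    define x where "x = 1 - s / N"
    have x: "0 \<le> x" "x \<le> exp (- (\<epsilon> / 2))"
      using N0 \<epsilon> exp_ge_add_one_self[of "- (\<epsilon> / 2)"] by (simp_all add: x_def s_def)
    have "x ^ L n \<le> exp (- (\<epsilon> / 2)) ^ L n" using x by (intro power_mono)
    also have "\<dots> = exp (- (\<epsilon> / 2 * real (L n)))" by (simp add: exp_of_nat_mult[symmetric] mult.commute)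
    also have "\<dots> \<le> exp (- (3 * ln (real n)))"
    proof -
      have "\<epsilon> / 2 * (c * ln (real n)) \<le> \<epsilon> / 2 * real (L n)"
        using Lb(1) \<epsilon> by (intro mult_left_mono) auto
      then show ?thesis using \<epsilon> by (simp add: c_def)
    qed
    also have "\<dots> = 1 / real n ^ 3"
      using n1 exp_of_nat_mult[of 3 "ln (real n)"] by (simp add: exp_minus field_simps)
    finally have "real n ^ 2 * x ^ L n \<le> real n ^ 2 * (1 / real n ^ 3)"
      by (rule mult_left_mono) simp
    also have "\<dots> = 1 / real n" using n1 by (simp add: field_simps eval_nat_numeral)
    finally have y: "real n ^ 2 * x ^ L n \<le> 1 / real n" .
    have y0: "0 \<le> real n ^ 2 * x ^ L n" using x by simp
    have "1 / real n \<le> 1" using n1 by simp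
    then have "(real n ^ 2 * x ^ L n) ^ L n \<le> (real n ^ 2 * x ^ L n) ^ 1"
      using y y0 L0 by (intro power_decreasing) linarith+
    then have yL: "(real n ^ 2 * x ^ L n) ^ L n \<le> 1 / real n" using y by simp
    let ?\<sigma> = "hamilton_strategy n (b n) (L n)"
    have "real (n * (b n + 1)) \<le> real ((n + m) * (b n + 1))"
      by (simp only: of_nat_le_iff) (rule mult_right_mono, auto)
    then have board0: "real (n * (b n + 1)) + s \<le> real (card (complete_edges n))"
      using board by (simp add: N_def)
    have bad: "measure_pmf.prob (half_random_game n (b n) ?\<sigma> n) {h. \<not> expanding n (L n) (claimed_by Breaker h)}
        \<le> (real n ^ 2 * x ^ L n) ^ L n + real n ^ 2 * x ^ L n"
      by (rule prob_not_expanding_le[OF legal_hamilton_strategy L0 s0 board0]) (simp add: x_def N_def)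
    have "measure_pmf.prob (half_random_game n (b n) ?\<sigma> (n + m)) (- maker_wins hamiltonicity_game n)
        \<le> measure_pmf.prob (half_random_game n (b n) ?\<sigma> n) {h. \<not> expanding n (L n) (claimed_by Breaker h)}
          + real m * real (m * (b n + 1)) / s"
      unfolding m_def
      by (rule prob_maker_loses_le[OF L0 Ln s0 _ refl]) (use board in \<open>simp only: m_def N_def\<close>)
    also have "\<dots> \<le> 2 / real n + real m * real (m * (b n + 1)) / s"
      using bad y yL by simp
    also have "real m * real (m * (b n + 1)) / s = real m ^ 2 * real (b n + 1) / s"
      unfolding of_nat_mult by (simp only: power2_eq_square mult.assoc)
    also have "\<dots> \<le> (12 * u n + 1) ^ 2 * ((1 - \<epsilon>) * (real n / 2) + 1) / s"
      using mu b1 s0 by (intro divide_right_mono mult_mono power_mono) auto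
    also have "2 / real n + \<dots> = r n" by (simp add: r_def s_def NK)
    finally have prob: "measure_pmf.prob (half_random_game n (b n) ?\<sigma> (n + m))
        (- maker_wins hamiltonicity_game n) \<le> r n" by simp
    have "real (n + m) \<le> real ((n + m) * (b n + 1))" by (simp only: of_nat_le_iff) simp
    also have "\<dots> \<le> real ((n + m) * (b n + 1)) + s" using s0 by simp
    also note board
    finally have "real (n + m) \<le> N" .
    then show ?case using prob by (simp only: m_def N_def of_nat_le_iff)
  qed
  from main show "eventually (\<lambda>n. n + (12 * L n + 1) \<le> card (complete_edges n)) sequentially"
    by (rule eventually_mono) blast
  have ge: "eventually (\<lambda>n. 1 - r n \<le> measure_pmf.prob
      (half_random_game n (b n) (hamilton_strategy n (b n) (L n)) (n + (12 * L n + 1)))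
      (maker_wins hamiltonicity_game n)) sequentially"
    using main
  proof eventually_elim
    case (elim n)
    then show ?case
      using measure_pmf.prob_compl[of "maker_wins hamiltonicity_game n"
          "half_random_game n (b n) (hamilton_strategy n (b n) (L n)) (n + (12 * L n + 1))"]
      by (simp add: Compl_eq_Diff_UNIV)
  qed
  have lim: "(\<lambda>n. 1 - r n) \<longlonglongrightarrow> 1" using tendsto_diff[OF tendsto_const r0, of 1] by simp
  from ge show "(\<lambda>n. measure_pmf.prob
      (half_random_game n (b n) (hamilton_strategy n (b n) (L n)) (n + (12 * L n + 1)))
      (maker_wins hamiltonicity_game n)) \<longlonglongrightarrow> 1"
    by (rule tendsto_sandwich[OF _ always_eventually lim tendsto_const]) simp
qed

text \<open>Maker never loses an edge, so a Hamilton cycle present after \<open>t\<close> rounds is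
  still there at the end of the full game.\<close>

lemma prob_maker_wins_mono:
  assumes W: "\<And>E. finite E \<Longrightarrow> hamiltonicity_game n E \<Longrightarrow> W n E"
    and t: "t \<le> card (complete_edges n)" and legal: "legal_strategy n \<sigma>"
  shows "measure_pmf.prob (half_random_game n b \<sigma> t) (maker_wins hamiltonicity_game n)
    \<le> measure_pmf.prob (full_half_random_game n b \<sigma>) (maker_wins W n)"
proof -
  define r where "r = card (complete_edges n) - t"
  have full: "full_half_random_game n b \<sigma> =
      bind_pmf (half_random_game n b \<sigma> t) (continued_game n b \<sigma> r)"
    using t half_random_game_add[of n b \<sigma> t r] by (simp add: full_half_random_game_def r_def)
  let ?p = "half_random_game n b \<sigma> t"
  have "ennreal (measure_pmf.prob ?p (maker_wins hamiltonicity_game n))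
      = (\<integral>\<^sup>+h. indicator (maker_wins hamiltonicity_game n) h \<partial>measure_pmf ?p)"
    by (simp add: measure_pmf.emeasure_eq_measure)
  also have "\<dots> \<le> (\<integral>\<^sup>+h. emeasure (continued_game n b \<sigma> r h) (maker_wins W n) \<partial>measure_pmf ?p)"
  proof (rule nn_integral_mono)
    fix h
    show "indicator (maker_wins hamiltonicity_game n) h
        \<le> emeasure (continued_game n b \<sigma> r h) (maker_wins W n)"
    proof (cases "h \<in> maker_wins hamiltonicity_game n")
      case True
      have "h' \<in> maker_wins W n" if h': "h' \<in> set_pmf (continued_game n b \<sigma> r h)" for h'
      proof -
        have "claimed_by Maker h \<subseteq> claimed_by Maker h'"
          using continued_game_append[OF h' legal] by (auto simp: claimed_by_append)
        then have "hamiltonicity_game n (claimed_by Maker h')"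
          using True unfolding maker_wins_def hamiltonicity_game_def by blast
        then show ?thesis using W by (simp add: maker_wins_def)
      qed
      then have "measure_pmf.prob (continued_game n b \<sigma> r h) (maker_wins W n) = 1"
        by (subst measure_pmf.prob_eq_1) (auto simp: AE_measure_pmf_iff)
      then show ?thesis using True by (simp add: measure_pmf.emeasure_eq_measure)
    qed simp
  qed
  also have "\<dots> = ennreal (measure_pmf.prob (full_half_random_game n b \<sigma>) (maker_wins W n))"
    by (simp add: full measure_pmf.emeasure_eq_measure[symmetric])
  finally show ?thesis by simp
qed

text \<open>The three games share their threshold because each lies between two properties: owning
  at least \<open>n - 1\<close> edges, and Hamiltonicity. The value n / 2 enters as
  \<open>n div 2\<close> because a threshold is integer-valued.\<close>

lemma sharp_threshold_biasI:
  assumes few: "\<And>n E. W n E \<Longrightarrow> E \<subseteq> complete_edges n \<Longrightarrow> n \<le> card E + 1"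
    and ham: "\<And>n E. finite E \<Longrightarrow> hamiltonicity_game n E \<Longrightarrow> W n E"
  shows "sharp_threshold_bias W (\<lambda>n. n div 2)"
  unfolding sharp_threshold_bias_def
proof (intro allI impI conjI)
  fix \<epsilon> :: real and S :: "nat \<Rightarrow> strategy"
  assume "0 < \<epsilon>" "\<forall>n. legal_strategy n (S n)"
  then show "(\<lambda>n. measure_pmf.prob (full_half_random_game n (bias ((1 + \<epsilon>) * real (n div 2))) (S n))
               (breaker_wins W n)) \<longlonglongrightarrow> 1"
    using few by (intro breaker_wins_above_threshold) auto
next
  fix \<epsilon> :: real
  assume "0 < \<epsilon>"
  define \<delta> where "\<delta> = min \<epsilon> (1 / 2)"
  define b where "b n = bias ((1 - \<epsilon>) * real (n div 2))" for n
  define L where "L = depth \<delta>"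
  define S where "S n = hamilton_strategy n (b n) (L n)" for n
  have \<delta>: "0 < \<delta>" "\<delta> < 1" using \<open>0 < \<epsilon>\<close> by (auto simp: \<delta>_def)
  have b: "real (b n) \<le> (1 - \<delta>) * (real n / 2)" for n
    unfolding b_def \<delta>_def by (rule bias_le) linarith+
  note wins = hamilton_strategy_wins[of \<delta> b, OF \<delta> b, folded L_def, folded S_def]
  have legal: "legal_strategy n (S n)" for n by (simp add: S_def legal_hamilton_strategy)
  have "eventually (\<lambda>n. measure_pmf.prob (half_random_game n (b n) (S n) (n + (12 * L n + 1)))
      (maker_wins hamiltonicity_game n)
    \<le> measure_pmf.prob (full_half_random_game n (b n) (S n)) (maker_wins W n)) sequentially"
    using wins(2) by eventually_elim (rule prob_maker_wins_mono[OF ham _ legal])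
  then have "(\<lambda>n. measure_pmf.prob (full_half_random_game n (b n) (S n)) (maker_wins W n)) \<longlonglongrightarrow> 1"
    by (rule tendsto_sandwich[OF _ always_eventually wins(1) tendsto_const]) simp
  then show "\<exists>S. (\<forall>n. legal_strategy n (S n)) \<and>
        (\<lambda>n. measure_pmf.prob (full_half_random_game n (bias ((1 - \<epsilon>) * real (n div 2))) (S n))
               (maker_wins W n)) \<longlonglongrightarrow> 1"
    using legal unfolding b_def by blast
qed

theorem theorem2:
  "(\<forall>\<epsilon>::real. \<epsilon> > 0 \<longrightarrow>
      (\<exists>(S :: nat \<Rightarrow> strategy) (m :: nat \<Rightarrow> nat).
         (\<forall>n. legal_strategy n (S n)) \<and>
         (\<lambda>n. real (m n)) \<in> O(\<lambda>n. ln (real n)) \<and>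
         (\<lambda>n. measure_pmf.prob
                (half_random_game n (bias ((1 - \<epsilon>) * (real n / 2))) (S n) (n + m n))
                (maker_wins hamiltonicity_game n)) \<longlonglongrightarrow> 1)) \<and>
   sharp_threshold_bias connectivity_game (\<lambda>n. n div 2) \<and>
   sharp_threshold_bias min_degree_2_game (\<lambda>n. n div 2) \<and>
   sharp_threshold_bias hamiltonicity_game (\<lambda>n. n div 2)"
proof (intro conjI allI impI)
  fix \<epsilon> :: real
  assume "0 < \<epsilon>"
  define \<delta> where "\<delta> = min \<epsilon> (1 / 2)"
  define b where "b n = bias ((1 - \<epsilon>) * (real n / 2))" for n :: nat
  define m where "m n = 12 * depth \<delta> n + 1" for n
  define S where "S n = hamilton_strategy n (b n) (depth \<delta> n)" for n
  have \<delta>: "0 < \<delta>" "\<delta> < 1" using \<open>0 < \<epsilon>\<close> by (auto simp: \<delta>_def)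
  have b: "real (b n) \<le> (1 - \<delta>) * (real n / 2)" for n
    unfolding b_def \<delta>_def by (rule bias_le) auto
  have "(\<lambda>n. real (m n)) \<in> O(\<lambda>n. 12 * (6 / \<delta> * ln (real n) + 1) + 1)"
  proof (rule landau_o.big_mono)
    show "eventually (\<lambda>n. norm (real (m n)) \<le> norm (12 * (6 / \<delta> * ln (real n) + 1) + 1)) sequentially"
      using eventually_ge_at_top[of 1]
    proof eventually_elim
      case (elim n)
      then show ?case using depth_bounds(2)[OF \<delta>(1) elim] by (simp add: m_def)
    qed
  qed
  also have "(\<lambda>n. 12 * (6 / \<delta> * ln (real n) + 1) + 1) \<in> O(\<lambda>n. ln (real n))"
    using \<delta>(1) by real_asymp
  finally have "(\<lambda>n. real (m n)) \<in> O(\<lambda>n. ln (real n))" .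
  moreover have "(\<lambda>n. measure_pmf.prob (half_random_game n (b n) (S n) (n + m n))
      (maker_wins hamiltonicity_game n)) \<longlonglongrightarrow> 1"
    unfolding S_def m_def by (rule hamilton_strategy_wins(1)[OF \<delta> b])
  moreover have "legal_strategy n (S n)" for n by (simp add: S_def legal_hamilton_strategy)
  ultimately show "\<exists>S m. (\<forall>n. legal_strategy n (S n)) \<and>
         (\<lambda>n. real (m n)) \<in> O(\<lambda>n. ln (real n)) \<and>
         (\<lambda>n. measure_pmf.prob
                (half_random_game n (bias ((1 - \<epsilon>) * (real n / 2))) (S n) (n + m n))
                (maker_wins hamiltonicity_game n)) \<longlonglongrightarrow> 1"
    unfolding b_def by blast
next
  show "sharp_threshold_bias connectivity_game (\<lambda>n. n div 2)"
    by (rule sharp_threshold_biasI[OF connected_card hamilton_imp_connected])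
  show "sharp_threshold_bias min_degree_2_game (\<lambda>n. n div 2)"
    by (rule sharp_threshold_biasI[OF trans_le_add1[OF min_degree_2_card] hamilton_imp_min_degree_2])
  show "sharp_threshold_bias hamiltonicity_game (\<lambda>n. n div 2)"
    by (rule sharp_threshold_biasI[OF connected_card[OF hamilton_imp_connected]])
qed

end
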